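(* The following problems are decidable: (i) (comparison) given a finite alphabet $\Sigma$ and two max-plus automata $A,B$ over $\Sigma$, each with at most two states, decide whether $[\![A]\!](w)\le[\![B]\!](w)$ for every $w\in\Sigma^*$; (ii) (equivalence) given a finite alphabet $\Sigma$ and two max-plus automata $A,B$ over $\Sigma$, each with at most two states, decide whether $[\![A]\!](w)=[\![B]\!](w)$ for every $w\in\Sigma^*$; (iii) (positivity) for every finite alphabet size $k$, the problem $\mathrm{Pos}^2_k(\mathbb{Z}_{\max})$: given a two-state max-plus automaton $B$ over an alphabet $\Sigma$ with $|\Sigma|=k$, decide whether $[\![B]\!](w)\ge 0$ for every $w\in\Sigma^*$.
   Context: $\mathbb{Z}_{\max}=(\mathbb{Z}\cup\{-\infty\},\max,+)$ is the max-plus semiring, with $-\infty$ absorbing for $+$ and least in the order $\le$. A finite max-plus automaton $A$ over a finite alphabet $\Sigma$ with $d$ states consists of an initial row vector $\lambda\in\mathbb{Z}_{\max}^{1\times d}$, a transition matrix $M_\sigma\in\mathbb{Z}_{\max}^{d\times d}$ for each $\sigma\in\Sigma$, and a final column vector $\phi\in\mathbb{Z}_{\max}^{d\times 1}$; all weights are arbitrary elements of $\mathbb{Z}\cup\{-\infty\}$. It computes the series $[\![A]\!]:\Sigma^*\to\mathbb{Z}\cup\{-\infty\}$ given by $[\![A]\!](\sigma_1\cdots\sigma_n)=\lambda M_{\sigma_1}\cdots M_{\sigma_n}\phi$ (max-plus matrix products; the empty word has value $\lambda\phi$). Decidable means that there is an algorithm that, on input (finite descriptions of) the given data, always terminates with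 the correct yes/no answer. *)

theory Defs
  imports "HOL-Library.Nat_Bijection" "Jordan_Normal_Form.Matrix"
begin

section \<open>The max-plus semiring\<close>

datatype zmax = NegInf | Fin int

instantiation zmax :: linorder
begin

fun less_eq_zmax :: "zmax \<Rightarrow> zmax \<Rightarrow> bool" where
  "NegInf \<le> y \<longleftrightarrow> True"
| "Fin a \<le> NegInf \<longleftrightarrow> False"
| "Fin a \<le> Fin b \<longleftrightarrow> a \<le> b"

definition less_zmax :: "zmax \<Rightarrow> zmax \<Rightarrow> bool" where
  "x < y \<longleftrightarrow> x \<le> y \<and> \<not> y \<le> (x::zmax)"

instance
proof
  fix x y z :: zmax
  show "x < y \<longleftrightarrow> x \<le> y \<and> \<not> y \<le> x" by (fact less_zmax_def)
  show "x \<le> x" by (cases x) auto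
  show "x \<le> y \<Longrightarrow> y \<le> z \<Longrightarrow> x \<le> z" by (cases x; cases y; cases z) auto
  show "x \<le> y \<Longrightarrow> y \<le> x \<Longrightarrow> x = y" by (cases x; cases y) auto
  show "x \<le> y \<or> y \<le> x" by (cases x; cases y) auto
qed

end

text \<open>The class operations are the semiring ones: addition is \<open>max\<close> and multiplication is
  integer addition. So the class constants \<open>0\<close> and \<open>1\<close> denote \<open>NegInf\<close> and \<open>Fin 0\<close>; the
  integer zero must always be written \<open>Fin 0\<close>.\<close>

instantiation zmax :: comm_semiring_1
begin

definition zero_zmax :: zmax where "0 = NegInf"

definition one_zmax :: zmax where "1 = Fin 0"

definition plus_zmax :: "zmax \<Rightarrow> zmax \<Rightarrow> zmax" where "plus_zmax x y = max x y"

fun times_zmax :: "zmax \<Rightarrow> zmax \<Rightarrow> zmax" where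
  "NegInf * y = NegInf"
| "Fin a * NegInf = NegInf"
| "Fin a * Fin b = Fin (a + b)"

instance
proof
  fix a b c :: zmax
  show "a + b + c = a + (b + c)" by (simp add: plus_zmax_def max.assoc)
  show "a + b = b + a" by (simp add: plus_zmax_def max.commute)
  show "0 + a = a" by (simp add: plus_zmax_def zero_zmax_def max_def)
  show "a * b * c = a * (b * c)" by (cases a; cases b; cases c) auto
  show "a * b = b * a" by (cases a; cases b) auto
  show "1 * a = a" by (cases a) (auto simp: one_zmax_def)
  show "(a + b) * c = a * c + b * c"
    by (cases a; cases b; cases c) (auto simp: plus_zmax_def max_def)
  show "0 * a = 0" "a * 0 = 0" by (cases a; simp add: zero_zmax_def)+
  show "(0::zmax) \<noteq> 1" by (simp add: zero_zmax_def one_zmax_def)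
qed

end

section \<open>Max-plus automata\<close>

text \<open>A finite alphabet with \<open>k\<close> letters is \<open>{..<k}\<close>; the transition matrix of the letter
  \<open>s\<close> is the list entry \<open>transitions A ! s\<close>.\<close>

datatype maxplus_automaton =
  Automaton (states: nat) (initial: "zmax mat") (transitions: "zmax mat list") (final: "zmax mat")

definition automaton_over :: "nat \<Rightarrow> maxplus_automaton \<Rightarrow> bool" where
  "automaton_over k A \<longleftrightarrow>
     initial A \<in> carrier_mat 1 (states A) \<and>
     length (transitions A) = k \<and>
     set (transitions A) \<subseteq> carrier_mat (states A) (states A) \<and>
     final A \<in> carrier_mat (states A) 1"

definition series :: "maxplus_automaton \<Rightarrow> nat list \<Rightarrow> zmax" where
  "series A w = (foldl (\<lambda>v s. v * transitions A ! s) (initial A) w * final A) $$ (0, 0)"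

abbreviation words :: "nat \<Rightarrow> nat list set" where
  "words k \<equiv> lists {..<k}"

section \<open>Decidability\<close>

text \<open>Algorithms are programs for partial recursive functions. \<open>PrimRec f g\<close> recurses on the
  first argument, \<open>g\<close> receiving the predecessor, the previous value and the parameters;
  \<open>Minim f\<close> is unbounded minimization over the first argument of \<open>f\<close>.\<close>

datatype recf = Zero | Succ | Proj nat | Comp recf "recf list" | PrimRec recf recf | Minim recf

text \<open>\<open>computes p xs y\<close>: the program \<open>p\<close> halts on the arguments \<open>xs\<close> with result \<open>y\<close>.\<close>

inductive computes :: "recf \<Rightarrow> nat list \<Rightarrow> nat \<Rightarrow> bool" where
  Zero: "computes Zero xs 0"
| Succ: "computes Succ (x # xs) (Suc x)"
| Proj: "i < length xs \<Longrightarrow> computes (Proj i) xs (xs ! i)"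
| Comp: "list_all2 (\<lambda>g y. computes g xs y) gs ys \<Longrightarrow> computes f ys z \<Longrightarrow>
    computes (Comp f gs) xs z"
| PrimRec_0: "computes f xs z \<Longrightarrow> computes (PrimRec f g) (0 # xs) z"
| PrimRec_Suc: "computes (PrimRec f g) (n # xs) r \<Longrightarrow> computes g (n # r # xs) z \<Longrightarrow>
    computes (PrimRec f g) (Suc n # xs) z"
| Minim: "computes f (n # xs) 0 \<Longrightarrow> (\<forall>m<n. \<exists>y. computes f (m # xs) (Suc y)) \<Longrightarrow>
    computes (Minim f) xs n"

lemma computes_deterministic:
  "computes p xs y \<Longrightarrow> computes p xs z \<Longrightarrow> y = z"
proof (induction arbitrary: z rule: computes.induct)
  case (Zero xs)
  then show ?case by (auto elim: computes.cases)
next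
  case (Succ x xs)
  then show ?case by (auto elim: computes.cases)
next
  case (Proj i xs)
  from Proj.prems show ?case by (cases rule: computes.cases) auto
next
  case (Comp xs gs ys f y)
  from Comp.prems obtain zs where zs: "list_all2 (\<lambda>g y. computes g xs y) gs zs"
    and f: "computes f zs z"
    by (cases rule: computes.cases) auto
  have "ys = zs"
  proof (rule nth_equalityI)
    show "length ys = length zs"
      using list_all2_lengthD[OF Comp.IH(1)] list_all2_lengthD[OF zs] by simp
    show "ys ! i = zs ! i" if "i < length ys" for i
      using that Comp.IH(1) zs by (auto simp: list_all2_conv_all_nth)
  qed
  then show ?case using Comp.IH f by blast
next
  case (PrimRec_0 f xs y g)
  from PrimRec_0.prems show ?case by (cases rule: computes.cases) (auto intro: PrimRec_0.IH)
next
  case (PrimRec_Suc f g n xs r y)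
  from PrimRec_Suc.prems obtain r' where "computes (PrimRec f g) (n # xs) r'"
    "computes g (n # r' # xs) z"
    by (cases rule: computes.cases) auto
  then show ?case using PrimRec_Suc.IH by blast
next
  case (Minim f n xs)
  from Minim.prems have z: "computes f (z # xs) 0"
    "\<forall>m<z. \<exists>y. computes f (m # xs) (Suc y)"
    by (cases rule: computes.cases; auto)+
  show ?case
  proof (rule linorder_cases)
    assume "n < z"
    then obtain y where "computes f (n # xs) (Suc y)" using z by blast
    then show ?thesis using Minim.IH(1) by blast
  next
    assume "z < n"
    then obtain y where "\<forall>v. computes f (z # xs) v \<longrightarrow> Suc y = v" using Minim.IH(2) by blast
    then show ?thesis using z(1) by blast
  qed
qed

text \<open>Instances of a decision problem form a set \<open>I\<close> and are presented to the algorithm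
  through the coding \<open>enc\<close>. Termination is demanded on codes of instances only.\<close>

definition decidable :: "('a \<Rightarrow> nat) \<Rightarrow> 'a set \<Rightarrow> ('a \<Rightarrow> bool) \<Rightarrow> bool" where
  "decidable enc I P \<longleftrightarrow>
     (\<exists>p. \<forall>x\<in>I. computes p [enc x] (if P x then 1 else 0))"

section \<open>Coding of automata\<close>

fun zmax_encode :: "zmax \<Rightarrow> nat" where
  "zmax_encode NegInf = 0"
| "zmax_encode (Fin a) = Suc (int_encode a)"

definition mat_encode :: "zmax mat \<Rightarrow> nat" where
  "mat_encode M = list_encode (map (\<lambda>r. list_encode (map zmax_encode r)) (mat_to_list M))"

definition automaton_encode :: "maxplus_automaton \<Rightarrow> nat" where
  "automaton_encode A = list_encode
     [states A, mat_encode (initial A), list_encode (map mat_encode (transitions A)),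
      mat_encode (final A)]"

definition pair_encode :: "nat \<times> maxplus_automaton \<times> maxplus_automaton \<Rightarrow> nat" where
  "pair_encode = (\<lambda>(k, A, B). list_encode [k, automaton_encode A, automaton_encode B])"

lemma zmax_encode_inject: "zmax_encode x = zmax_encode y \<Longrightarrow> x = y"
  by (cases x; cases y) (auto simp: int_encode_eq)

lemma mat_encode_inject:
  assumes "M \<in> carrier_mat m n" "N \<in> carrier_mat m n" "mat_encode M = mat_encode N"
  shows "M = N"
proof (rule eq_matI)
  have "inj (\<lambda>r. list_encode (map zmax_encode r))"
    by (intro injI) (auto simp: list_encode_eq dest!: map_injective intro: injI zmax_encode_inject)
  then have eq: "mat_to_list M = mat_to_list N"
    using assms(3) by (auto simp: mat_encode_def list_encode_eq dest: map_injective)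
  show "M $$ (i, j) = N $$ (i, j)" if "i < dim_row N" "j < dim_col N" for i j
    using arg_cong[OF eq, of "\<lambda>l. l ! i ! j"] that assms(1,2) by (auto simp: mat_to_list_def)
qed (use assms in auto)

lemma automaton_encode_inject:
  assumes A: "automaton_over k A" and B: "automaton_over l B"
    and eq: "automaton_encode A = automaton_encode B"
  shows "A = B"
proof (rule maxplus_automaton.expand, intro conjI)
  have d: "states A = states B" and i: "mat_encode (initial A) = mat_encode (initial B)"
    and t: "map mat_encode (transitions A) = map mat_encode (transitions B)"
    and f: "mat_encode (final A) = mat_encode (final B)"
    using eq by (auto simp: automaton_encode_def list_encode_eq)
  show "states A = states B" by (fact d)
  show "initial A = initial B" "final A = final B"
    using A B d i f by (auto simp: automaton_over_def intro: mat_encode_inject)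
  have "inj_on mat_encode (set (transitions A) \<union> set (transitions B))"
  proof (rule inj_on_subset)
    show "inj_on mat_encode (carrier_mat (states B) (states B))"
      by (intro inj_onI) (rule mat_encode_inject)
    show "set (transitions A) \<union> set (transitions B) \<subseteq> carrier_mat (states B) (states B)"
      using A B d by (simp add: automaton_over_def)
  qed
  with t show "transitions A = transitions B" by (rule map_inj_on)
qed

end

theory Submission
  imports Defs "HOL-Library.More_List"
begin

text \<open>A run of \<open>A\<close> is a path in a finite graph. Multiplying the matrices of \<open>B\<close> along the path and
  subtracting the weights of the run, the comparison fails iff some path yields a negative value.
  Up to a common shift, a vector with two finite entries is the difference of its entries. A matrix
  acts on it by finitely many cases when the difference is small. When it is large, the matrix adds
  a constant to it, possibly swapping the entries, or forgets one of the two entries. So the vector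
  is simulated by a one-counter machine whose transitions have integer costs, and the question is
  whether the machine has an accepting path of negative cost.

  Such paths are the derivations of a weighted context-free grammar with finitely many
  nonterminals. If all derivations from the start symbol have nonnegative weight, then a
  nonterminal that occurs in some such derivation has a least derivable weight; these weights form
  a finite certificate that can be checked rule by rule. Conversely a path of negative value is a
  finite witness, and an unbounded search finds one or the other.\<close>

section \<open>Computable functions\<close>

text \<open>The costs have both signs, so the least weight of a nonterminal may be - \<infinity>,
  and no bound on the length of a bad path is at hand. None is sought: least weights serve only to
  show that a certificate exists, and the program merely checks guesses.

  The grammar can be finite because above all heights named in the rules the machine acts alike at
  every height. A stretch of path that stays high is a translate of a lower one, so it can be named
  by two ends of bounded height. Tests for a particular height are confined to exact rules.

  A matrix that forgets the counter cannot do so in one step: the counter may be arbitrarily large,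
  and the smallest finite entry may have grown with it. So the counter is emptied unit by unit, at
  cost 1 per unit if the surviving entries grow with it and at cost 0 otherwise.

  Equivalence is the conjunction of two comparisons, and positivity is comparison with the constant
  series 0.\<close>

lemma computes_Comp1: "computes g xs y \<Longrightarrow> computes f [y] z \<Longrightarrow> computes (Comp f [g]) xs z"
  by (rule computes.Comp[of _ _ "[y]"]) auto

lemma computes_Comp2:
  "computes g xs y \<Longrightarrow> computes h xs y' \<Longrightarrow> computes f [y, y'] z \<Longrightarrow> computes (Comp f [g, h]) xs z"
  by (rule computes.Comp[of _ _ "[y, y']"]) auto

lemma computes_Proj: "i < length xs \<Longrightarrow> y = xs ! i \<Longrightarrow> computes (Proj i) xs y"
  using computes.Proj by simp

section \<open>Arithmetic and the Cantor pairing as explicit programs\<close>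

definition pr_add :: recf where "pr_add = PrimRec (Proj 0) (Comp Succ [Proj 1])"

lemma pr_add: "computes pr_add [m, n] (m + n)"
  unfolding pr_add_def
proof (induction m)
  case 0
  show ?case by (auto intro!: computes.PrimRec_0 computes_Proj)
next
  case (Suc m)
  show ?case
    by (rule computes.PrimRec_Suc[OF Suc.IH])
      (auto intro!: computes_Comp1 computes_Proj computes.Succ)
qed

definition pr_pred :: recf where "pr_pred = PrimRec Zero (Proj 0)"

lemma pr_pred: "computes pr_pred [n] (n - 1)"
  unfolding pr_pred_def
proof (induction n)
  case 0
  show ?case by (auto intro!: computes.PrimRec_0 computes.Zero)
next
  case (Suc n)
  show ?case by (rule computes.PrimRec_Suc[OF Suc.IH]) (auto intro!: computes_Proj)
qed

text \<open>The arguments are swapped because \<open>PrimRec\<close> recurses on its first argument,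
  which here is the number of decrements.\<close>

definition pr_rsub :: recf where "pr_rsub = PrimRec (Proj 0) (Comp pr_pred [Proj 1])"

lemma pr_rsub: "computes pr_rsub [m, n] (n - m)"
  unfolding pr_rsub_def
proof (induction m)
  case 0
  show ?case by (auto intro!: computes.PrimRec_0 computes_Proj)
next
  case (Suc m)
  have "computes pr_pred [n - m] (n - Suc m)" using pr_pred[of "n - m"] by simp
  then show ?case
    by (intro computes.PrimRec_Suc[OF Suc.IH]) (auto intro!: computes_Comp1 computes_Proj)
qed

definition pr_triangle :: recf where
  "pr_triangle = PrimRec Zero (Comp pr_add [Proj 1, Comp Succ [Proj 0]])"

lemma pr_triangle: "computes pr_triangle [n] (triangle n)"
  unfolding pr_triangle_def
proof (induction n)
  case 0
  show ?case by (auto intro!: computes.PrimRec_0 computes.Zero)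
next
  case (Suc n)
  have "computes pr_add [triangle n, Suc n] (triangle (Suc n))"
    using pr_add[of "triangle n" "Suc n"] by simp
  then show ?case
    by (intro computes.PrimRec_Suc[OF Suc.IH])
      (auto intro!: computes_Comp1 computes_Comp2 computes_Proj computes.Succ)
qed

definition pr_pair :: recf where
  "pr_pair = Comp pr_add [Comp pr_triangle [pr_add], Proj 0]"

lemma pr_pair: "computes pr_pair [m, n] (prod_encode (m, n))"
  unfolding pr_pair_def prod_encode_def prod.case
  by (intro computes_Comp2[OF computes_Comp1[OF pr_add pr_triangle] computes_Proj pr_add]) auto

definition pr_root :: recf where
  "pr_root = Minim (Comp pr_rsub [Comp pr_triangle [Comp Succ [Proj 0]], Comp Succ [Proj 1]])"

text \<open>The code is \<open>triangle (m + n) + m\<close>, which lies below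
  \<open>triangle (Suc (m + n))\<close>. So the diagonal \<open>m + n\<close> is the least
  \<open>k\<close> with \<open>?z < triangle (Suc k)\<close>, and truncated subtraction from
  \<open>Suc ?z\<close> vanishes exactly for such \<open>k\<close>.\<close>

lemma pr_root: "computes pr_root [prod_encode (m, n)] (m + n)"
proof -
  let ?z = "prod_encode (m, n)"
  let ?f = "Comp pr_rsub [Comp pr_triangle [Comp Succ [Proj 0]], Comp Succ [Proj 1]]"
  have f: "computes ?f [k, ?z] (Suc ?z - triangle (Suc k))" for k
  proof (rule computes_Comp2[OF _ _ pr_rsub])
    show "computes (Comp pr_triangle [Comp Succ [Proj 0]]) [k, ?z] (triangle (Suc k))"
      by (rule computes_Comp1[OF computes_Comp1[OF computes_Proj computes.Succ] pr_triangle]) auto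
    show "computes (Comp Succ [Proj 1]) [k, ?z] (Suc ?z)"
      by (rule computes_Comp1[OF computes_Proj computes.Succ]) auto
  qed
  have mono: "triangle i \<le> triangle j" if "i \<le> j" for i j
    using that by (induction rule: dec_induct) auto
  have "Suc ?z - triangle (Suc (m + n)) = 0" by (simp add: prod_encode_def)
  moreover have "\<exists>y. Suc ?z - triangle (Suc k) = Suc y" if "k < m + n" for k
  proof -
    have "triangle (Suc k) \<le> ?z"
      using mono[of "Suc k" "m + n"] that by (simp add: prod_encode_def)
    then show ?thesis by presburger
  qed
  ultimately show ?thesis
    unfolding pr_root_def using f[of "m + n"] f by (intro computes.Minim allI impI) (simp, metis)
qed

definition pr_fst :: recf where
  "pr_fst = Comp pr_rsub [Comp pr_triangle [pr_root], Proj 0]"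

lemma pr_fst: "computes pr_fst [prod_encode (m, n)] m"
proof -
  have "prod_encode (m, n) - triangle (m + n) = m" by (simp add: prod_encode_def)
  then show ?thesis
    unfolding pr_fst_def using pr_rsub[of "triangle (m + n)" "prod_encode (m, n)"]
    by (intro computes_Comp2[OF computes_Comp1[OF pr_root pr_triangle] computes_Proj]) auto
qed

definition pr_snd :: recf where "pr_snd = Comp pr_rsub [pr_fst, pr_root]"

lemma pr_snd: "computes pr_snd [prod_encode (m, n)] n"
  unfolding pr_snd_def using pr_rsub[of m "m + n"]
  by (intro computes_Comp2[OF pr_fst pr_root]) auto

section \<open>Codings of types and closure properties of computable functions\<close>

class code =
  fixes encode :: "'a \<Rightarrow> nat"

text \<open>Surjectivity lets \<open>decode\<close> read any number as a value, so that a search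
  over all numbers ranges over all values. The law is kept out of \<open>code\<close>, whose
  instances include automata: their codes do not exhaust the numbers.\<close>

class bcode = code +
  assumes bij_encode: "bij encode"

lemma encode_inject [simp]: "encode x = encode y \<longleftrightarrow> x = (y :: 'a :: bcode)"
  using bij_encode[where 'a='a] by (auto simp: bij_def inj_eq)

definition decode :: "nat \<Rightarrow> 'a :: bcode" where "decode = inv_into UNIV encode"

lemma encode_decode [simp]: "encode (decode n :: 'a :: bcode) = n"
  unfolding decode_def using bij_encode[where 'a='a] by (auto intro: surj_f_inv_f simp: bij_def)

lemma decode_encode [simp]: "decode (encode x) = x"
  using encode_inject encode_decode by metis

instantiation nat :: bcode
begin
definition encode_nat :: "nat \<Rightarrow> nat" where [simp]: "encode_nat n = n"
instance by standard (simp add: bij_betw_def inj_on_def image_iff set_eq_iff)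
end

instantiation bool :: code
begin
definition encode_bool :: "bool \<Rightarrow> nat" where "encode_bool b = (if b then 1 else 0)"
instance ..
end

instantiation int :: bcode
begin
definition encode_int :: "int \<Rightarrow> nat" where "encode_int = int_encode"
instance by standard (simp add: encode_int_def bij_int_encode)
end

instantiation prod :: (code, code) code
begin
definition encode_prod :: "'a \<times> 'b \<Rightarrow> nat" where
  "encode_prod p = prod_encode (encode (fst p), encode (snd p))"
instance ..
end

instance prod :: (bcode, bcode) bcode
proof
  have "(encode :: 'a \<times> 'b \<Rightarrow> nat) = prod_encode \<circ> map_prod encode encode"
    by (auto simp: encode_prod_def)
  moreover have "bij (map_prod (encode :: 'a \<Rightarrow> nat) (encode :: 'b \<Rightarrow> nat))"
    using bij_betw_map_prod[OF bij_encode bij_encode] by simp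
  ultimately show "bij (encode :: 'a \<times> 'b \<Rightarrow> nat)"
    using bij_comp[OF _ bij_prod_encode, of "map_prod encode encode"] by metis
qed

instantiation list :: (code) code
begin
definition encode_list :: "'a list \<Rightarrow> nat" where "encode_list xs = list_encode (map encode xs)"
instance ..
end

instance list :: (bcode) bcode
proof
  have "(encode :: 'a list \<Rightarrow> nat) = list_encode \<circ> map encode"
    by (auto simp: encode_list_def)
  moreover have "bij (map (encode :: 'a \<Rightarrow> nat))"
    using bij_encode[where 'a='a] lists_image[of encode "UNIV :: 'a set"]
    by (simp add: bij_def image_def lists_UNIV)
  ultimately show "bij (encode :: 'a list \<Rightarrow> nat)"
    using bij_comp[OF _ bij_list_encode, of "map encode"] by metis
qed

instantiation zmax :: code
begin
definition encode_zmax :: "zmax \<Rightarrow> nat" where "encode_zmax = zmax_encode"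
instance ..
end

instantiation maxplus_automaton :: code
begin
definition encode_maxplus_automaton :: "maxplus_automaton \<Rightarrow> nat" where
  "encode_maxplus_automaton = automaton_encode"
instance ..
end

text \<open>The program has to halt on every number, not only on codes; so both branches of a
  conditional may be evaluated.\<close>

definition computable :: "('a::code \<Rightarrow> 'b::code) \<Rightarrow> bool" where
  "computable f \<longleftrightarrow>
     (\<exists>p g. (\<forall>n. computes p [n] (g n)) \<and> (\<forall>x. g (encode x) = encode (f x)))"

lemma computable_nat:
  fixes f :: "nat \<Rightarrow> nat"
  shows "computable f \<longleftrightarrow> (\<exists>p. \<forall>n. computes p [n] (f n))"
  unfolding computable_def by (auto simp: fun_eq_iff) metis

lemma computable_lift:
  "computable f \<longleftrightarrow>
     (\<exists>g :: nat \<Rightarrow> nat. computable g \<and> (\<forall>x. g (encode x) = encode (f x)))"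
  unfolding computable_nat by (auto simp: computable_def)

lemma computableI:
  assumes "computable (g :: nat \<Rightarrow> nat)" "\<And>x. g (encode x) = encode (f x)"
  shows "computable f"
  using assms computable_lift by blast

lemma computableE:
  assumes "computable f"
  obtains g :: "nat \<Rightarrow> nat" where "computable g" "\<And>x. g (encode x) = encode (f x)"
  using assms computable_lift by metis

lemma computable_id: "computable (\<lambda>x. x)"
  unfolding computable_def by (auto intro!: exI[of _ "Proj 0"] exI[of _ "\<lambda>n. n"] computes_Proj)

lemma computable_compose:
  assumes "computable f" "computable g"
  shows "computable (\<lambda>x. f (g x))"
proof -
  obtain p f' q g' where "\<forall>n. computes p [n] (f' n)" "\<forall>x. f' (encode x) = encode (f x)"
    "\<forall>n. computes q [n] (g' n)" "\<forall>x. g' (encode x) = encode (g x)"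
    using assms unfolding computable_def by auto
  then show ?thesis
    unfolding computable_def
    by (intro exI[of _ "Comp p [q]"] exI[of _ "\<lambda>n. f' (g' n)"]) (auto intro: computes_Comp1)
qed

lemma computable_const_nat: "computable (\<lambda>x. n :: nat)"
proof (rule computableI)
  show "computable (\<lambda>x :: nat. n)"
  proof (induction n)
    case 0
    then show ?case unfolding computable_nat using computes.Zero by blast
  next
    case (Suc n)
    then obtain p where "\<forall>x. computes p [x] n" unfolding computable_nat by blast
    then have "\<forall>x. computes (Comp Succ [p]) [x] (Suc n)"
      by (auto intro: computes_Comp1 computes.Succ)
    then show ?case unfolding computable_nat by blast
  qed
qed auto

lemma computable_const: "computable (\<lambda>x. c)"
  by (rule computableI[OF computable_const_nat[of "encode c"]]) auto

lemma computable_Pair: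
  assumes "computable f" "computable g"
  shows "computable (\<lambda>x. (f x, g x))"
proof -
  obtain p f' q g' where "\<forall>n. computes p [n] (f' n)" "\<forall>x. f' (encode x) = encode (f x)"
    "\<forall>n. computes q [n] (g' n)" "\<forall>x. g' (encode x) = encode (g x)"
    using assms unfolding computable_def by auto
  then show ?thesis
    unfolding computable_def
    by (intro exI[of _ "Comp pr_pair [p, q]"] exI[of _ "\<lambda>n. prod_encode (f' n, g' n)"])
      (auto intro: computes_Comp2 pr_pair simp: encode_prod_def)
qed

lemma computable_nat_fst: "computable (\<lambda>n. fst (prod_decode n))"
proof -
  have "computes pr_fst [n] (fst (prod_decode n))" for n
    using pr_fst[of "fst (prod_decode n)" "snd (prod_decode n)"] by simp
  then show ?thesis unfolding computable_nat by blast
qed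

lemma computable_nat_snd: "computable (\<lambda>n. snd (prod_decode n))"
proof -
  have "computes pr_snd [n] (snd (prod_decode n))" for n
    using pr_snd[of "fst (prod_decode n)" "snd (prod_decode n)"] by simp
  then show ?thesis unfolding computable_nat by blast
qed

lemma computable_fst: "computable f \<Longrightarrow> computable (\<lambda>x. fst (f x))"
  by (rule computable_compose[of fst])
    (auto intro: computableI[OF computable_nat_fst] simp: encode_prod_def)

lemma computable_snd: "computable f \<Longrightarrow> computable (\<lambda>x. snd (f x))"
  by (rule computable_compose[of snd])
    (auto intro: computableI[OF computable_nat_snd] simp: encode_prod_def)

lemma computable_encode: "computable f \<Longrightarrow> computable (\<lambda>x. encode (f x))"
  unfolding computable_def by simp

lemma computable_decode: "computable f \<Longrightarrow> computable (\<lambda>x. decode (f x))"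
  unfolding computable_def by simp

lemma computable_Suc: "computable f \<Longrightarrow> computable (\<lambda>x. Suc (f x))"
proof (rule computable_compose[of Suc])
  show "computable Suc" unfolding computable_nat using computes.Succ by blast
qed

lemma computable_rec_nat_nat:
  fixes b s n :: "nat \<Rightarrow> nat"
  assumes "computable b" "computable s" "computable n"
  shows "computable (\<lambda>x. rec_nat (b x) (\<lambda>m r. s (prod_encode (m, prod_encode (r, x)))) (n x))"
proof -
  obtain pb ps pn where p: "\<And>x. computes pb [x] (b x)" "\<And>x. computes ps [x] (s x)"
    "\<And>x. computes pn [x] (n x)"
    using assms unfolding computable_nat by blast
  let ?s = "Comp ps [Comp pr_pair [Proj 0, Comp pr_pair [Proj 1, Proj 2]]]"
  have s: "computes ?s [m, r, x] (s (prod_encode (m, prod_encode (r, x))))" for m r x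
    by (rule computes_Comp1[OF computes_Comp2[OF computes_Proj
            computes_Comp2[OF computes_Proj computes_Proj pr_pair] pr_pair] p(2)]) auto
  have "computes (PrimRec pb ?s) [k, x]
      (rec_nat (b x) (\<lambda>m r. s (prod_encode (m, prod_encode (r, x)))) k)" for k x
  proof (induction k)
    case 0
    show ?case by (auto intro: computes.PrimRec_0 p)
  next
    case (Suc k)
    show ?case using computes.PrimRec_Suc[OF Suc s] by simp
  qed
  then have "computes (Comp (PrimRec pb ?s) [pn, Proj 0]) [x]
      (rec_nat (b x) (\<lambda>m r. s (prod_encode (m, prod_encode (r, x)))) (n x))" for x
    by (auto intro: computes_Comp2[OF p(3) computes_Proj])
  then show ?thesis unfolding computable_nat by blast
qed

lemma computable_rec_nat:
  assumes "computable b" "computable (\<lambda>p. s (fst p) (fst (snd p)) (snd (snd p)))" "computable n"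
  shows "computable (\<lambda>x. rec_nat (b x) (\<lambda>m r. s m r x) (n x))"
proof -
  obtain b' where b: "computable b'" "\<And>x. b' (encode x) = encode (b x)"
    using computableE[OF assms(1)] by blast
  obtain s' where s: "computable s'"
    "\<And>x. s' (encode x) = encode (s (fst x) (fst (snd x)) (snd (snd x)))"
    using computableE[OF assms(2)] by blast
  obtain n' where n: "computable n'" "\<And>x. n' (encode x) = encode (n x)"
    using computableE[OF assms(3)] by blast
  show ?thesis
  proof (rule computableI[OF computable_rec_nat_nat[OF b(1) s(1) n(1)]])
    fix x
    have s': "s' (prod_encode (m, prod_encode (encode r, encode x))) = encode (s m r x)" for m r
      using s(2)[of "(m, r, x)"] by (simp add: encode_prod_def)
    have "rec_nat (encode (b x)) (\<lambda>m r. s' (prod_encode (m, prod_encode (r, encode x)))) k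
      = encode (rec_nat (b x) (\<lambda>m r. s m r x) k)" for k
      by (induction k) (auto simp: s')
    then show "rec_nat (b' (encode x)) (\<lambda>m r. s' (prod_encode (m, prod_encode (r, encode x))))
        (n' (encode x)) = encode (rec_nat (b x) (\<lambda>m r. s m r x) (n x))"
      by (simp add: b n)
  qed
qed

named_theorems computable

lemmas [computable] = computable_const computable_id computable_Pair computable_fst computable_snd
  computable_encode computable_decode computable_Suc computable_rec_nat

lemma computable_plus_nat [computable]:
  "computable f \<Longrightarrow> computable g \<Longrightarrow> computable (\<lambda>x. f x + g x :: nat)"
proof -
  assume "computable f" "computable g"
  then have "computable (\<lambda>x. rec_nat (f x) (\<lambda>m r. Suc r) (g x))" by (intro computable)
  moreover have "rec_nat a (\<lambda>m r. Suc r) b = a + b" for a b by (induction b) auto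
  ultimately show ?thesis by simp
qed

lemma computable_pred: "computable f \<Longrightarrow> computable (\<lambda>x. f x - Suc 0)"
proof -
  assume "computable f"
  then have "computable (\<lambda>x. rec_nat 0 (\<lambda>m r. m) (f x))" by (intro computable)
  moreover have "rec_nat 0 (\<lambda>m r. m) b = b - Suc 0" for b by (cases b) auto
  ultimately show ?thesis by simp
qed

lemma computable_minus_nat [computable]:
  "computable f \<Longrightarrow> computable g \<Longrightarrow> computable (\<lambda>x. f x - g x :: nat)"
proof -
  assume "computable f" "computable g"
  then have "computable (\<lambda>x. rec_nat (f x) (\<lambda>m r. r - Suc 0) (g x))"
    by (intro computable computable_pred)
  moreover have "rec_nat a (\<lambda>m r. r - Suc 0) b = a - b" for a b by (induction b) auto
  ultimately show ?thesis by simp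
qed

lemma computable_If [computable]:
  assumes "computable c" "computable f" "computable g"
  shows "computable (\<lambda>x. if c x then f x else g x)"
proof -
  \<comment> \<open>The code of a truth value is \<open>0\<close> or \<open>1\<close>, so it counts
    how often the step replaces the base \<open>g x\<close> by \<open>f x\<close>.\<close>
  have "computable (\<lambda>x. rec_nat (g x) (\<lambda>m r. f x) (encode (c x)))"
    using assms by (intro computable computable_compose[OF assms(2)])
  moreover have "rec_nat (g x) (\<lambda>m r. f x) (encode (c x)) = (if c x then f x else g x)" for x
    by (auto simp: encode_bool_def)
  ultimately show ?thesis by simp
qed

lemma computable_conj [computable]:
  "computable P \<Longrightarrow> computable Q \<Longrightarrow> computable (\<lambda>x. P x \<and> Q x)"
proof -
  assume "computable P" "computable Q"
  then have "computable (\<lambda>x. if P x then Q x else False)"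
    by (intro computable_If computable_const)
  moreover have "(\<lambda>x. if P x then Q x else False) = (\<lambda>x. P x \<and> Q x)" by auto
  ultimately show ?thesis by simp
qed

lemma computable_disj [computable]:
  "computable P \<Longrightarrow> computable Q \<Longrightarrow> computable (\<lambda>x. P x \<or> Q x)"
proof -
  assume "computable P" "computable Q"
  then have "computable (\<lambda>x. if P x then True else Q x)"
    by (intro computable_If computable_const)
  moreover have "(\<lambda>x. if P x then True else Q x) = (\<lambda>x. P x \<or> Q x)" by auto
  ultimately show ?thesis by simp
qed

lemma computable_Not [computable]: "computable P \<Longrightarrow> computable (\<lambda>x. \<not> P x)"
  using computable_If[of P, OF _ computable_const[of False] computable_const[of True]]
  by (simp only: if_bool_eq_conj) simp

lemma computable_nat_eq_0: "computable f \<Longrightarrow> computable (\<lambda>x. f x = (0 :: nat))"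
proof -
  assume "computable f"
  then have "computable (\<lambda>x. rec_nat True (\<lambda>m r. False) (f x))" by (intro computable)
  moreover have "rec_nat True (\<lambda>m r. False) b = (b = 0)" for b by (cases b) auto
  ultimately show ?thesis by simp
qed

lemma computable_le_nat [computable]:
  "computable f \<Longrightarrow> computable g \<Longrightarrow> computable (\<lambda>x. f x \<le> (g x :: nat))"
  using computable_nat_eq_0[OF computable_minus_nat, of f g] by simp

lemma computable_less_nat [computable]:
  "computable f \<Longrightarrow> computable g \<Longrightarrow> computable (\<lambda>x. f x < (g x :: nat))"
  unfolding not_le[symmetric] by (intro computable)

lemma computable_eq [computable]:
  fixes f g :: "_ \<Rightarrow> 'a :: bcode"
  assumes "computable f" "computable g"
  shows "computable (\<lambda>x. f x = g x)"
proof -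
  have "computable (\<lambda>x. encode (f x) \<le> encode (g x) \<and> encode (g x) \<le> encode (f x))"
    by (intro computable assms)
  then show ?thesis by (simp flip: eq_iff)
qed

lemma computable_case_list [computable]:
  assumes "computable l" "computable a" "computable (\<lambda>p. f (fst p) (fst (snd p)) (snd (snd p)))"
  shows "computable (\<lambda>x. case l x of [] \<Rightarrow> a x | y # ys \<Rightarrow> f y ys x)"
proof -
  obtain l' where l: "computable l'" "\<And>x. l' (encode x) = encode (l x)"
    using computableE[OF assms(1)] by blast
  obtain a' where a: "computable a'" "\<And>x. a' (encode x) = encode (a x)"
    using computableE[OF assms(2)] by blast
  obtain f' where f: "computable f'"
    "\<And>x. f' (encode x) = encode (f (fst x) (fst (snd x)) (snd (snd x)))"
    using computableE[OF assms(3)] by blast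
  \<comment> \<open>A nonempty list is coded by the successor of the pair of head and tail.
    Recursion on the code acts only as a case distinction: the step ignores \<open>r\<close>, so the
    last predecessor \<open>m\<close>, which is the pair code, determines the result.\<close>
  have "computable (\<lambda>x. rec_nat (a' x) (\<lambda>m r. f' (encode (fst (decode m :: nat \<times> nat),
      snd (decode m :: nat \<times> nat), x))) (l' x))"
    by (intro computable computable_compose[OF f(1)] a(1) l(1))
  then show ?thesis
  proof (rule computableI)
    fix x
    have inv: "decode (prod_encode q) = q" for q :: "nat \<times> nat"
      using decode_encode[of q] by (simp add: encode_prod_def)
    have "f' (prod_encode (encode y, prod_encode (encode ys, encode x))) = encode (f y ys x)" for y ys
      using f(2)[of "(y, ys, x)"] by (simp add: encode_prod_def)
    then show "rec_nat (a' (encode x)) (\<lambda>m r. f' (encode (fst (decode m :: nat \<times> nat),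
        snd (decode m :: nat \<times> nat), encode x))) (l' (encode x))
      = encode (case l x of [] \<Rightarrow> a x | y # ys \<Rightarrow> f y ys x)"
      by (cases "l x") (auto simp: a l encode_list_def inv encode_prod_def[where 'a=nat]
        encode_prod_def)
  qed
qed

lemma computable_Cons [computable]:
  assumes "computable f" "computable g"
  shows "computable (\<lambda>x. f x # g x)"
proof -
  have "computable (\<lambda>x. Suc (encode (f x, g x)))" by (intro computable assms)
  then show ?thesis
    by (simp add: computable_def encode_list_def encode_prod_def)
qed

lemma length_le_encode: "length xs \<le> encode xs"
proof (induction xs)
  case (Cons a xs)
  have "encode xs \<le> prod_encode (encode a, encode xs)" by (rule le_prod_encode_2)
  with Cons show ?case by (simp add: encode_list_def)
qed auto

text \<open>Primitive recursion needs the number of steps in advance. The code of the list serves,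
  since by \<open>length_le_encode\<close> it is at least the length; surplus steps find an empty
  list and do nothing.\<close>

lemma computable_foldl [computable]:
  fixes f :: "'b :: code \<Rightarrow> 'c :: code \<Rightarrow> 'a :: code \<Rightarrow> 'b"
  assumes "computable b" "computable l"
    "computable (\<lambda>p. f (fst p) (fst (snd p)) (snd (snd p)))"
  shows "computable (\<lambda>x. foldl (\<lambda>s a. f s a x) (b x) (l x))"
proof -
  let ?step = "\<lambda>x r. case snd r of [] \<Rightarrow> r | y # ys \<Rightarrow> (f (fst r) y x, ys)"
  have step: "computable (\<lambda>x. f (u x) (v x) (w x))"
    if "computable u" "computable v" "computable w" for u v and w :: "_ \<Rightarrow> 'a"
    using computable_compose[OF assms(3), of "\<lambda>x. (u x, v x, w x)"] that
    by (simp add: computable_Pair)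
  have "computable (\<lambda>x. fst (rec_nat (b x, l x) (\<lambda>m r. ?step x r) (encode (l x))))"
    by (intro computable step assms)
  moreover have "fst (rec_nat (s, xs) (\<lambda>m r. ?step x r) n) = foldl (\<lambda>s a. f s a x) s xs"
    if "length xs \<le> n" for n s xs x
  proof -
    \<comment> \<open>The step ignores the index, so one application can be split off at the start,
      where \<open>foldl\<close> consumes the list.\<close>
    have "rec_nat q (\<lambda>m r. ?step x r) (Suc n) = rec_nat (?step x q) (\<lambda>m r. ?step x r) n" for q n
      by (induction n) auto
    then show ?thesis using that
    proof (induction n arbitrary: s xs)
      case (Suc n)
      then show ?case by (cases xs) (auto simp del: nat.rec(2))
    qed auto
  qed
  ultimately show ?thesis
    by (simp only: length_le_encode)
qed

section \<open>Lists, integers and decision problems\<close>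

lemma computable_rev [computable]:
  fixes f :: "'b :: code \<Rightarrow> 'a :: code list"
  shows "computable f \<Longrightarrow> computable (\<lambda>x. rev (f x))"
proof -
  assume "computable f"
  then have "computable (\<lambda>x. foldl (\<lambda>s a. a # s) [] (f x))" by (intro computable)
  moreover have "foldl (\<lambda>s a. a # s) ys xs = rev xs @ ys" for xs ys :: "'a list"
    by (induction xs arbitrary: ys) auto
  ultimately show ?thesis by simp
qed

lemma computable_append [computable]:
  fixes f :: "'b :: code \<Rightarrow> 'a :: code list"
  shows "computable f \<Longrightarrow> computable g \<Longrightarrow> computable (\<lambda>x. f x @ g x)"
proof -
  assume "computable f" "computable g"
  then have "computable (\<lambda>x. foldl (\<lambda>s a. a # s) (g x) (rev (f x)))" by (intro computable)
  moreover have "foldl (\<lambda>s a. a # s) ys (rev xs) = xs @ ys" for xs ys :: "'a list"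
    by (induction xs arbitrary: ys) auto
  ultimately show ?thesis by simp
qed

lemma computable_map [computable]:
  assumes "computable (\<lambda>p. f (fst p) (snd p))" "computable l"
  shows "computable (\<lambda>x. map (\<lambda>a. f a x) (l x))"
proof -
  have f: "computable (\<lambda>x. f (u x) (v x))" if "computable u" "computable v" for u v
    using computable_compose[OF assms(1) computable_Pair[OF that]] by simp
  have "computable (\<lambda>x. rev (foldl (\<lambda>s a. f a x # s) [] (l x)))"
    by (intro computable f assms)
  moreover have "foldl (\<lambda>s a. f a x # s) ys xs = rev (map (\<lambda>a. f a x) xs) @ ys" for xs ys x
    by (induction xs arbitrary: ys) auto
  ultimately show ?thesis by simp
qed

lemma computable_concat [computable]:
  fixes f :: "'b :: code \<Rightarrow> 'a :: code list list"
  shows "computable f \<Longrightarrow> computable (\<lambda>x. concat (f x))"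
proof -
  assume "computable f"
  then have "computable (\<lambda>x. foldl (\<lambda>s a. s @ a) [] (f x))" by (intro computable)
  moreover have "foldl (\<lambda>s a. s @ a) ys xs = ys @ concat xs" for xs and ys :: "'a list"
    by (induction xs arbitrary: ys) auto
  ultimately show ?thesis by simp
qed

lemma computable_length [computable]:
  fixes f :: "'b :: code \<Rightarrow> 'a :: code list"
  shows "computable f \<Longrightarrow> computable (\<lambda>x. length (f x))"
proof -
  assume "computable f"
  then have "computable (\<lambda>x. foldl (\<lambda>s a. Suc s) 0 (f x))" by (intro computable)
  moreover have "foldl (\<lambda>s a. Suc s) n xs = n + length xs" for n and xs :: "'a list"
    by (induction xs arbitrary: n) auto
  ultimately show ?thesis by simp
qed

lemma computable_sum_list [computable]:
  "computable f \<Longrightarrow> computable (\<lambda>x. sum_list (f x) :: nat)"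
proof -
  assume "computable f"
  then have "computable (\<lambda>x. foldl (\<lambda>s a. s + a) 0 (f x))" by (intro computable)
  moreover have "foldl (\<lambda>s a. s + a) n xs = n + sum_list xs" for n and xs :: "nat list"
    by (induction xs arbitrary: n) auto
  ultimately show ?thesis by simp
qed

lemma computable_list_all [computable]:
  assumes "computable (\<lambda>p. P (fst p) (snd p))" "computable l"
  shows "computable (\<lambda>x. list_all (\<lambda>a. P a x) (l x))"
proof -
  have P: "computable (\<lambda>x. P (u x) (v x))" if "computable u" "computable v" for u v
    using computable_compose[OF assms(1) computable_Pair[OF that]] by simp
  have "computable (\<lambda>x. foldl (\<lambda>s a. s \<and> P a x) True (l x))"
    by (intro computable P assms)
  moreover have "foldl (\<lambda>s a. s \<and> P a x) b xs = (b \<and> list_all (\<lambda>a. P a x) xs)" for b xs x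
    by (induction xs arbitrary: b) auto
  ultimately show ?thesis by simp
qed

lemma computable_upt [computable]: "computable n \<Longrightarrow> computable (\<lambda>x. [0..<n x])"
proof -
  assume "computable n"
  then have "computable (\<lambda>x. rec_nat [] (\<lambda>m r. r @ [m]) (n x))" by (intro computable)
  moreover have "rec_nat [] (\<lambda>m r. r @ [m]) k = [0..<k]" for k
    by (induction k) auto
  ultimately show ?thesis by simp
qed

lemma computable_nth_default [computable]:
  fixes l :: "'b :: code \<Rightarrow> 'a :: code list"
  assumes "computable d" "computable l" "computable n"
  shows "computable (\<lambda>x. nth_default (d x) (l x) (n x))"
proof -
  have "computable (\<lambda>x. case rec_nat (l x) (\<lambda>m r. case r of [] \<Rightarrow> [] | y # ys \<Rightarrow> ys) (n x) of
      [] \<Rightarrow> d x | y # ys \<Rightarrow> y)"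
    by (intro computable assms)
  moreover have "rec_nat xs (\<lambda>m r. case r of [] \<Rightarrow> [] | y # ys \<Rightarrow> ys) k = drop k xs"
    for xs :: "'a list" and k
  proof (induction k)
    case (Suc k)
    then show ?case by (cases "drop k xs") (auto simp: drop_Suc tl_drop[symmetric])
  qed simp
  moreover have "(case drop k xs of [] \<Rightarrow> y | z # zs \<Rightarrow> z) = nth_default y xs k"
    for xs and y :: 'a and k
    by (cases "k < length xs") (simp_all add: nth_default_def Cons_nth_drop_Suc[symmetric])
  ultimately show ?thesis by simp
qed

text \<open>\<open>int_encode\<close> sends \<open>i \<ge> 0\<close> to \<open>2 * i\<close> and
  \<open>i < 0\<close> to \<open>- 2 * i - 1\<close>. Integer arithmetic is done on positive and
  negative parts, which parity and halving recover from the code.\<close>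

lemma int_encode_conv: "int_encode (int a - int b) =
    (if b \<le> a then (a - b) + (a - b) else (b - a) + (b - a) - 1)"
  by (auto simp: int_encode_def sum_encode_def)

lemma int_encode_nat: "nat i = (if even (int_encode i) then int_encode i div 2 else 0)"
  by (auto simp: int_encode_def sum_encode_def)

lemma computable_half_parity:
  assumes "computable (f :: _ \<Rightarrow> nat)"
  shows "computable (\<lambda>x. f x div 2)" "computable (\<lambda>x. even (f x))"
proof -
  define r where "r = rec_nat (0, 0) (\<lambda>m r. if snd r = 0 then (fst r, 1) else (Suc (fst r), 0 :: nat))"
  have r: "r k = (k div 2, k mod 2)" for k
    by (induction k) (auto simp: r_def div_Suc mod_Suc)
  have *: "computable (\<lambda>x. r (f x))" unfolding r_def by (intro computable assms)
  from computable_fst[OF *] show "computable (\<lambda>x. f x div 2)" by (simp add: r)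
  have "computable (\<lambda>x. snd (r (f x)) = 0)" by (intro computable *)
  then show "computable (\<lambda>x. even (f x))" by (simp add: r even_iff_mod_2_eq_zero)
qed

lemma computable_nat_int [computable]:
  assumes "computable f"
  shows "computable (\<lambda>x. nat (f x))"
proof -
  have "computable (\<lambda>x. if even (encode (f x)) then encode (f x) div 2 else 0)"
    by (intro computable computable_half_parity assms)
  then show ?thesis unfolding encode_int_def int_encode_nat[symmetric] .
qed

lemma computable_nat_uminus_int:
  assumes "computable f"
  shows "computable (\<lambda>x. nat (- f x))"
proof -
  have "computable (\<lambda>x. if even (encode (f x)) then 0 else Suc (encode (f x) div 2))"
    by (intro computable computable_half_parity assms)
  moreover have "(if even (encode i) then 0 else Suc (encode i div 2)) = nat (- i)" for i :: int
    by (auto simp: encode_int_def int_encode_def sum_encode_def)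
  ultimately show ?thesis by simp
qed

lemma computable_int_minus_int:
  assumes "computable f" "computable g"
  shows "computable (\<lambda>x. int (f x) - int (g x))"
proof -
  have "computable (\<lambda>x. decode (if g x \<le> f x then (f x - g x) + (f x - g x)
      else (g x - f x) + (g x - f x) - 1) :: int)"
    by (intro computable computable_decode assms)
  moreover have "decode (if b \<le> a then (a - b) + (a - b) else (b - a) + (b - a) - 1) = int a - int b"
    for a b
    by (subst encode_inject[symmetric], subst encode_decode)
      (simp add: encode_int_def int_encode_conv)
  ultimately show ?thesis by simp
qed

lemma computable_of_nat_int [computable]: "computable f \<Longrightarrow> computable (\<lambda>x. int (f x))"
  using computable_int_minus_int[OF _ computable_const[of 0]] by simp

lemma computable_plus_int [computable]:
  assumes "computable f" "computable g"
  shows "computable (\<lambda>x. f x + g x :: int)"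
proof -
  have "computable (\<lambda>x. int (nat (f x) + nat (g x)) - int (nat (- f x) + nat (- g x)))"
    by (intro computable_int_minus_int computable computable_nat_uminus_int assms)
  moreover have "int (nat i + nat j) - int (nat (- i) + nat (- j)) = i + j" for i j by auto
  ultimately show ?thesis by simp
qed

lemma computable_uminus_int [computable]:
  assumes "computable f"
  shows "computable (\<lambda>x. - f x :: int)"
proof -
  have "computable (\<lambda>x. int (nat (- f x)) - int (nat (f x)))"
    by (intro computable_int_minus_int computable computable_nat_uminus_int assms)
  moreover have "int (nat (- i)) - int (nat i) = - i" for i by auto
  ultimately show ?thesis by simp
qed

lemma computable_minus_int [computable]:
  "computable f \<Longrightarrow> computable g \<Longrightarrow> computable (\<lambda>x. f x - g x :: int)"
  unfolding diff_conv_add_uminus by (intro computable)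

lemma computable_abs_int [computable]: "computable f \<Longrightarrow> computable (\<lambda>x. nat \<bar>f x\<bar>)"
proof -
  assume "computable f"
  then have "computable (\<lambda>x. nat (f x) + nat (- f x))" by (intro computable)
  moreover have "nat i + nat (- i) = nat \<bar>i\<bar>" for i by auto
  ultimately show ?thesis by simp
qed

lemma computable_le_int [computable]:
  "computable f \<Longrightarrow> computable g \<Longrightarrow> computable (\<lambda>x. f x \<le> (g x :: int))"
proof -
  assume "computable f" "computable g"
  then have "computable (\<lambda>x. nat (f x - g x) = 0)" by (intro computable)
  then show ?thesis by simp
qed

lemma computable_less_int [computable]:
  "computable f \<Longrightarrow> computable g \<Longrightarrow> computable (\<lambda>x. f x < (g x :: int))"
  unfolding not_le[symmetric] by (intro computable)

lemma computable_Fin [computable]: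
  assumes "computable f"
  shows "computable (\<lambda>x. Fin (f x))"
proof -
  have "computable (\<lambda>x. Suc (encode (f x)))" by (intro computable assms)
  then show ?thesis
    by (simp add: computable_def encode_zmax_def encode_int_def)
qed

lemma computable_case_zmax [computable]:
  assumes "computable z" "computable a" "computable (\<lambda>p. f (fst p) (snd p))"
  shows "computable (\<lambda>x. case z x of NegInf \<Rightarrow> a x | Fin i \<Rightarrow> f i x)"
proof -
  have f: "computable (\<lambda>x. f (u x) (v x))" if "computable u" "computable v" for u v
    using computable_compose[OF assms(3) computable_Pair[OF that]] by simp
  have enc: "computable (\<lambda>x. encode (z x))" by (intro computable assms)
  have "computable (\<lambda>x. rec_nat (a x) (\<lambda>m r. f (decode m) x) (encode (z x)))"
    by (intro computable f assms)
  moreover have "rec_nat (a x) (\<lambda>m r. f (decode m) x) (encode y) =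
      (case y of NegInf \<Rightarrow> a x | Fin i \<Rightarrow> f i x)" for x y
    using decode_encode[where 'a=int] by (cases y) (auto simp: encode_zmax_def encode_int_def)
  ultimately show ?thesis by simp
qed

lemma times_zmax_conv:
  "x * y = (case x of NegInf \<Rightarrow> NegInf | Fin i \<Rightarrow> (case y of NegInf \<Rightarrow> NegInf | Fin j \<Rightarrow> Fin (i + j)))"
  by (auto split: zmax.split)

lemma plus_zmax_conv:
  "x + y = (case x of NegInf \<Rightarrow> y | Fin i \<Rightarrow>
     (case y of NegInf \<Rightarrow> Fin i | Fin j \<Rightarrow> if i \<le> j then Fin j else Fin i))"
  by (auto simp: plus_zmax_def max_def split: zmax.split)

lemma computable_times_zmax [computable]:
  assumes "computable f" "computable g"
  shows "computable (\<lambda>x. f x * g x :: zmax)"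
proof -
  have "computable (\<lambda>p :: zmax \<times> zmax. fst p * snd p)"
    unfolding times_zmax_conv by (intro computable)
  from computable_compose[OF this computable_Pair[OF assms]] show ?thesis by simp
qed

lemma computable_plus_zmax [computable]:
  assumes "computable f" "computable g"
  shows "computable (\<lambda>x. f x + g x :: zmax)"
proof -
  have "computable (\<lambda>p :: zmax \<times> zmax. fst p + snd p)"
    unfolding plus_zmax_conv by (intro computable)
  from computable_compose[OF this computable_Pair[OF assms]] show ?thesis by simp
qed

text \<open>Post's theorem. On \<open>I\<close> one of the two witness predicates succeeds, so
  minimization over \<open>n\<close> halts; the first hit satisfies exactly one of them, and
  evaluating \<open>c\<close> there gives the answer.\<close>

lemma decidable_semidecidable:
  fixes c d :: "'a :: code \<times> nat \<Rightarrow> bool"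
  assumes "computable c" "computable d"
    and c: "\<And>x. x \<in> I \<Longrightarrow> P x \<longleftrightarrow> (\<exists>n. c (x, n))"
    and d: "\<And>x. x \<in> I \<Longrightarrow> \<not> P x \<longleftrightarrow> (\<exists>n. d (x, n))"
  shows "decidable encode I P"
proof -
  obtain p f where p: "\<And>n. computes p [n] (f n)" "\<And>y. f (encode y) = encode (c y)"
    using assms(1) unfolding computable_def by auto
  have "computable (\<lambda>y. if c y \<or> d y then 0 else Suc 0)" by (intro computable assms)
  then obtain q g where q: "\<And>n. computes q [n] (g n)"
    "\<And>y. g (encode y) = (if c y \<or> d y then 0 else Suc 0)"
    unfolding computable_def by auto
  let ?search = "Minim (Comp q [Comp pr_pair [Proj 1, Proj 0]])"
  have "computes (Comp p [Comp pr_pair [Proj 0, ?search]]) [encode x] (if P x then 1 else 0)"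
    if "x \<in> I" for x
  proof -
    define n where "n = (LEAST n. c (x, n) \<or> d (x, n))"
    have ex: "\<exists>n. c (x, n) \<or> d (x, n)" using c[OF that] d[OF that] by blast
    have n: "c (x, n) \<or> d (x, n)" unfolding n_def using ex by (rule LeastI_ex)
    have less: "\<not> (c (x, m) \<or> d (x, m))" if "m < n" for m
      using not_less_Least that unfolding n_def by blast
    have step: "computes (Comp q [Comp pr_pair [Proj 1, Proj 0]]) [m, encode x]
        (if c (x, m) \<or> d (x, m) then 0 else Suc 0)" for m
    proof -
      have "computes (Comp q [Comp pr_pair [Proj 1, Proj 0]]) [m, encode x]
          (g (prod_encode (encode x, m)))"
        by (rule computes_Comp1[OF computes_Comp2[OF computes_Proj computes_Proj pr_pair] q(1)]) auto
      then show ?thesis using q(2)[of "(x, m)"] by (simp add: encode_prod_def)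
    qed
    have "computes ?search [encode x] n"
    proof (rule computes.Minim)
      show "computes (Comp q [Comp pr_pair [Proj 1, Proj 0]]) [n, encode x] 0"
        using step[of n] n by simp
      show "\<forall>m<n. \<exists>y. computes (Comp q [Comp pr_pair [Proj 1, Proj 0]]) [m, encode x] (Suc y)"
      proof (intro allI impI)
        fix m
        assume "m < n"
        from step[of m] show "\<exists>y. computes (Comp q [Comp pr_pair [Proj 1, Proj 0]])
            [m, encode x] (Suc y)"
          unfolding if_not_P[OF less[OF \<open>m < n\<close>]] by blast
      qed
    qed
    from computes_Comp1[OF computes_Comp2[OF computes_Proj this pr_pair] p(1)]
    have "computes (Comp p [Comp pr_pair [Proj 0, ?search]]) [encode x]
        (f (prod_encode (encode x, n)))"
      by simp
    moreover have "f (prod_encode (encode x, n)) = encode (c (x, n))"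
      using p(2)[of "(x, n)"] by (simp add: encode_prod_def)
    moreover have "c (x, n) \<longleftrightarrow> P x" using n c[OF that] d[OF that] by blast
    ultimately show ?thesis by (simp add: encode_bool_def)
  qed
  then show ?thesis unfolding decidable_def by blast
qed

lemma decidable_reduce:
  assumes "decidable enc' J Q" "computable (g :: nat \<Rightarrow> nat)"
    and "\<And>x. x \<in> I \<Longrightarrow> f x \<in> J \<and> g (enc x) = enc' (f x) \<and> (P x \<longleftrightarrow> Q (f x))"
  shows "decidable enc I P"
proof -
  obtain p where p: "\<forall>x\<in>J. computes p [enc' x] (if Q x then 1 else 0)"
    using assms(1) unfolding decidable_def by blast
  obtain q where q: "\<forall>n. computes q [n] (g n)"
    using assms(2) unfolding computable_nat by blast
  have "computes (Comp p [q]) [enc x] (if P x then 1 else 0)" if "x \<in> I" for x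
  proof (rule computes_Comp1[OF q[rule_format]])
    show "computes p [g (enc x)] (if P x then 1 else 0)"
      using assms(3)[OF that] p[rule_format, of "f x"] by simp
  qed
  then show ?thesis unfolding decidable_def by blast
qed

lemma decidable_conj:
  assumes "decidable enc I P" "decidable enc I Q"
  shows "decidable enc I (\<lambda>x. P x \<and> Q x)"
proof -
  obtain p q where p: "\<forall>x\<in>I. computes p [enc x] (if P x then 1 else 0)"
    and q: "\<forall>x\<in>I. computes q [enc x] (if Q x then 1 else 0)"
    using assms unfolding decidable_def by blast
  have "computable (\<lambda>y. if fst y = (1 :: nat) \<and> snd y = (1 :: nat) then 1 else 0 :: nat)"
    unfolding One_nat_def by (intro computable)
  then obtain r f where r: "\<forall>n. computes r [n] (f n)"
    "\<forall>y. f (encode y) = (if fst y = (1 :: nat) \<and> snd y = (1 :: nat) then 1 else 0 :: nat)"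
    unfolding computable_def by auto
  have "computes (Comp r [Comp pr_pair [p, q]]) [enc x] (if P x \<and> Q x then 1 else 0)"
    if "x \<in> I" for x
  proof -
    let ?y = "(if P x then 1 else 0 :: nat, if Q x then 1 else 0 :: nat)"
    have "computes (Comp r [Comp pr_pair [p, q]]) [enc x] (f (encode ?y))"
      using computes_Comp1[OF computes_Comp2[OF p[rule_format, OF that] q[rule_format, OF that]
            pr_pair] r(1)[rule_format]]
      by (simp add: encode_prod_def)
    moreover have "f (encode ?y) = (if P x \<and> Q x then 1 else 0)"
      using r(2)[rule_format, of ?y] by simp
    ultimately show ?thesis by metis
  qed
  then show ?thesis unfolding decidable_def by blast
qed

section \<open>Weighted grammars\<close>

type_synonym wrule = "nat \<times> int \<times> nat \<times> nat"

text \<open>Nonterminal \<open>0\<close> derives the empty word, so that rules with fewer than two nonterminals on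
  the right need no separate format.\<close>

inductive derives :: "wrule list \<Rightarrow> nat \<Rightarrow> int \<Rightarrow> bool" for G where
  unit: "derives G 0 0"
| rule: "(i, c, j, k) \<in> set G \<Longrightarrow> derives G j u \<Longrightarrow> derives G k v \<Longrightarrow> derives G i (c + u + v)"

text \<open>An entry with tag \<open>0\<close> is a finite lower bound on the weights derivable from a nonterminal;
  tag \<open>1\<close> stands for \<open>-\<infinity>\<close> and the other tags for \<open>\<infinity>\<close>.\<close>

definition bound :: "(nat \<times> int) list \<Rightarrow> nat \<Rightarrow> nat \<times> int" where
  "bound W i = nth_default (2, 0) W i"

text \<open>This is the inequality "left bound \<le> cost + sum of the right bounds" over the
  extended integers, where \<infinity> absorbs - \<infinity>: a rule with an underivable nonterminal
  on the right constrains nothing.\<close>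

definition rule_ok :: "(nat \<times> int) list \<Rightarrow> wrule \<Rightarrow> bool" where
  "rule_ok W r \<longleftrightarrow>
     2 \<le> fst (bound W (fst (snd (snd r)))) \<or> 2 \<le> fst (bound W (snd (snd (snd r)))) \<or>
     fst (bound W (fst r)) = 1 \<or>
     fst (bound W (fst r)) = 0 \<and> fst (bound W (fst (snd (snd r)))) = 0 \<and>
     fst (bound W (snd (snd (snd r)))) = 0 \<and>
     snd (bound W (fst r)) \<le>
       fst (snd r) + snd (bound W (fst (snd (snd r)))) + snd (bound W (snd (snd (snd r))))"

definition nonneg_certificate :: "wrule list \<Rightarrow> nat \<Rightarrow> (nat \<times> int) list \<Rightarrow> bool" where
  "nonneg_certificate G s W \<longleftrightarrow>
     (fst (bound W 0) = 1 \<or> fst (bound W 0) = 0 \<and> snd (bound W 0) \<le> 0) \<and>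
     list_all (\<lambda>r. rule_ok W r) G \<and>
     (2 \<le> fst (bound W s) \<or> fst (bound W s) = 0 \<and> 0 \<le> snd (bound W s))"

text \<open>Induction on derivations: a solution of the rule inequalities lies below all derivable
  weights, and a derivable nonterminal cannot have a tag of 2 or more.\<close>

lemma nonneg_certificate_sound:
  assumes W: "nonneg_certificate G s W" and d: "derives G s w"
  shows "0 \<le> w"
proof -
  have "fst (bound W i) = 1 \<or> fst (bound W i) = 0 \<and> snd (bound W i) \<le> w" if "derives G i w" for i w
    using that
  proof induction
    case unit
    show ?case using W by (auto simp: nonneg_certificate_def)
  next
    case (rule i c j k u v)
    then have "rule_ok W (i, c, j, k)"
      using W by (auto simp: nonneg_certificate_def list_all_iff)
    with rule.IH show ?case by (auto simp: rule_ok_def)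
  qed
  from this[OF d] W show ?thesis by (auto simp: nonneg_certificate_def)
qed

text \<open>The sibling has to be derivable, so that a relevant nonterminal occurs in a context that
  can be completed to a derivation from \<open>s\<close>.\<close>

inductive relevant :: "wrule list \<Rightarrow> nat \<Rightarrow> nat \<Rightarrow> bool" for G s where
  start: "relevant G s s"
| left: "relevant G s i \<Longrightarrow> (i, c, j, k) \<in> set G \<Longrightarrow> derives G k v \<Longrightarrow> relevant G s j"
| right: "relevant G s i \<Longrightarrow> (i, c, j, k) \<in> set G \<Longrightarrow> derives G j u \<Longrightarrow> relevant G s k"

text \<open>\<open>d\<close> is the weight of everything outside one fixed occurrence of
  \<open>i\<close>; exchanging the subderivation at \<open>i\<close> leaves it unchanged.\<close>

lemma relevant_context:
  "relevant G s i \<Longrightarrow> \<exists>d. \<forall>w. derives G i w \<longrightarrow> derives G s (w + d)"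
proof (induction rule: relevant.induct)
  case start
  show ?case by (rule exI[of _ 0]) simp
next
  case (left i c j k v)
  then obtain d where d: "\<And>w. derives G i w \<Longrightarrow> derives G s (w + d)" by blast
  have "derives G s (w + (c + v + d))" if "derives G j w" for w
    using d[OF derives.rule[OF left.hyps(2) that left.hyps(3)]] by (simp add: algebra_simps)
  then show ?case by blast
next
  case (right i c j k u)
  then obtain d where d: "\<And>w. derives G i w \<Longrightarrow> derives G s (w + d)" by blast
  have "derives G s (w + (c + u + d))" if "derives G k w" for w
    using d[OF derives.rule[OF right.hyps(2,3) that]] by (simp add: algebra_simps)
  then show ?case by blast
qed

lemma int_bounded_below_least:
  fixes P :: "int \<Rightarrow> bool"
  assumes "P w" "\<And>w. P w \<Longrightarrow> b \<le> w"
  shows "\<exists>m. P m \<and> (\<forall>w. P w \<longrightarrow> m \<le> w)"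
proof -
  obtain m where m: "P m" "\<And>w. P w \<Longrightarrow> nat (m - b) \<le> nat (w - b)"
    using ex_has_least_nat[of P w "\<lambda>w. nat (w - b)"] assms(1) by blast
  then have "m \<le> w" if "P w" for w
    using assms(2)[of w] assms(2)[of m] m(2)[of w] that by linarith
  with m(1) show ?thesis by blast
qed

text \<open>The infimum of the derivable weights is finite for every relevant and productive nonterminal,
  since each of its derivations extends to one from the start symbol in a fixed context.\<close>

lemma nonneg_certificate_complete:
  assumes nonneg: "\<And>w. derives G s w \<Longrightarrow> 0 \<le> w"
  shows "\<exists>W. nonneg_certificate G s W"
proof -
  define least where "least i m \<longleftrightarrow> derives G i m \<and> (\<forall>w. derives G i w \<longrightarrow> m \<le> w)" for i m
  \<comment> \<open>An irrelevant nonterminal may have unboundedly negative weights, hence -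
    \<infinity>. This does not spread to relevant left sides: in their rules it can only stand
    beside an underivable sibling.\<close>
  define val where "val i =
    (if \<nexists>w. derives G i w then (2, 0) else if \<not> relevant G s i then (1, 0)
     else (0 :: nat, SOME m. least i m))" for i
  have least: "least i (snd (val i))" "fst (val i) = 0" if i: "derives G i w" "relevant G s i" for i w
  proof -
    obtain d where d: "\<And>w. derives G i w \<Longrightarrow> derives G s (w + d)"
      using relevant_context i(2) by blast
    have "- d \<le> w" if "derives G i w" for w using nonneg[OF d[OF that]] by simp
    with i(1) have "\<exists>m. least i m"
      unfolding least_def by (rule int_bounded_below_least)
    then have "least i (SOME m. least i m)" by (rule someI_ex)
    with i show "least i (snd (val i))" "fst (val i) = 0" by (auto simp: val_def)
  qed
  have unproductive: "val i = (2, 0)" if "\<nexists>w. derives G i w" for i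
    using that by (simp add: val_def)
  have irrelevant: "val i = (1, 0)" if "derives G i w" "\<not> relevant G s i" for i w
    using that by (auto simp: val_def)
  define nts where "nts = insert 0 (insert s (\<Union>(i, c, j, k)\<in>set G. {i, j, k}))"
  have "finite nts" by (auto simp: nts_def)
  then obtain M where M: "\<forall>i\<in>nts. i < M"
    unfolding finite_nat_set_iff_bounded by blast
  define W where "W = map val [0..<M]"
  have W: "bound W i = val i" if "i \<in> nts" for i
    using M[rule_format, OF that] by (simp add: bound_def W_def nth_default_def)
  have "rule_ok W (i, c, j, k)" if r: "(i, c, j, k) \<in> set G" for i c j k
  proof -
    have "i \<in> nts" "j \<in> nts" "k \<in> nts" unfolding nts_def using r by fast+
    note W = this[THEN W]
    show ?thesis
    proof (cases "(\<exists>u. derives G j u) \<and> (\<exists>v. derives G k v)")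
      case False
      then have "val j = (2, 0) \<or> val k = (2, 0)" using unproductive by blast
      then show ?thesis by (auto simp: rule_ok_def W)
    next
      case True
      then obtain u v where uv: "derives G j u" "derives G k v" by blast
      note i = derives.rule[OF r uv]
      show ?thesis
      proof (cases "relevant G s i")
        case False
        then show ?thesis using irrelevant[OF i] by (simp add: rule_ok_def W)
      next
        case True
        have j: "least j (snd (val j))" "fst (val j) = 0"
          by (intro least[OF uv(1)] relevant.left[OF True r uv(2)])+
        have k: "least k (snd (val k))" "fst (val k) = 0"
          by (intro least[OF uv(2)] relevant.right[OF True r uv(1)])+
        have "derives G i (c + snd (val j) + snd (val k))"
          using derives.rule[OF r] j k by (auto simp: least_def)
        then have "snd (val i) \<le> c + snd (val j) + snd (val k)"
          using least(1)[OF i True] by (auto simp: least_def)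
        then show ?thesis using least(2)[OF i True] j k by (simp add: rule_ok_def W)
      qed
    qed
  qed
  then have "list_all (\<lambda>r. rule_ok W r) G" by (auto simp: list_all_iff)
  moreover have "fst (val 0) = 1 \<or> fst (val 0) = 0 \<and> snd (val 0) \<le> 0"
  proof (cases "relevant G s 0")
    case True
    then show ?thesis using least[OF derives.unit] derives.unit by (auto simp: least_def)
  qed (simp add: irrelevant[OF derives.unit])
  moreover have "2 \<le> fst (val s) \<or> fst (val s) = 0 \<and> 0 \<le> snd (val s)"
  proof (cases "\<exists>w. derives G s w")
    case True
    then obtain w where "derives G s w" ..
    from least[OF this relevant.start] show ?thesis by (simp add: least_def nonneg)
  qed (simp add: unproductive)
  moreover have "bound W 0 = val 0" "bound W s = val s" by (simp_all add: W nts_def)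
  ultimately have "nonneg_certificate G s W"
    by (simp add: nonneg_certificate_def)
  then show ?thesis by blast
qed

lemma computable_nonneg_certificate [computable]:
  assumes "computable G" "computable s" "computable W"
  shows "computable (\<lambda>x. nonneg_certificate (G x) (s x) (W x))"
proof -
  have G: "computable (\<lambda>x. G (u x))" if "computable u" for u
    by (rule computable_compose[OF assms(1) that])
  have s: "computable (\<lambda>x. s (u x))" if "computable u" for u
    by (rule computable_compose[OF assms(2) that])
  have W: "computable (\<lambda>x. W (u x))" if "computable u" for u
    by (rule computable_compose[OF assms(3) that])
  show ?thesis
    unfolding nonneg_certificate_def rule_ok_def bound_def
    by (intro computable G s W assms)
qed

section \<open>One-counter machines with costs\<close>

text \<open>A one-counter automaton. Rules with flag \<open>True\<close> are its ordinary
  transitions, enabled from a least height upwards; those with flag \<open>False\<close> generalize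
  zero tests to an arbitrary fixed height.\<close>

type_synonym 'q mrule = "bool \<times> 'q \<times> nat \<times> int \<times> 'q \<times> nat"

inductive mpath :: "'q mrule list \<Rightarrow> 'q \<times> nat \<Rightarrow> int \<Rightarrow> 'q \<times> nat \<Rightarrow> bool" for R where
  refl: "mpath R a 0 a"
| exact: "(False, p, i, c, q, j) \<in> set R \<Longrightarrow> mpath R (q, j) w a \<Longrightarrow> mpath R (p, i) (c + w) a"
| shift: "(True, p, i, c, q, j) \<in> set R \<Longrightarrow> mpath R (q, j + t) w a \<Longrightarrow>
    mpath R (p, i + t) (c + w) a"

lemma mpath_trans: "mpath R a u b \<Longrightarrow> mpath R b v c \<Longrightarrow> mpath R a (u + v) c"
  by (induction rule: mpath.induct) (auto simp: add.assoc intro: mpath.intros)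

text \<open>Runs without height tests can be translated upwards, so they have summaries that do not
  depend on the absolute height. The list records the height after each step, to find places where a
  run can be cut.\<close>

inductive srun :: "'q mrule list \<Rightarrow> nat list \<Rightarrow> 'q \<times> nat \<Rightarrow> int \<Rightarrow> 'q \<times> nat \<Rightarrow> bool" for R where
  Nil: "srun R [] a 0 a"
| Cons: "(True, p, i, c, q, j) \<in> set R \<Longrightarrow> srun R hs (q, j + t) w a \<Longrightarrow>
    srun R ((j + t) # hs) (p, i + t) (c + w) a"

inductive_cases srun_NilE: "srun R [] a w b"
inductive_cases srun_ConsE: "srun R (h # hs) a w b"

lemma srun_append:
  "srun R (hs @ ks) a w b \<Longrightarrow> hs \<noteq> [] \<Longrightarrow>
    \<exists>q u v. srun R hs a u (q, last hs) \<and> srun R ks (q, last hs) v b \<and> w = u + v"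
proof (induction hs arbitrary: a w)
  case (Cons h hs)
  from Cons.prems(1) obtain p i c q j t w' where r: "a = (p, i + t)" "w = c + w'" "h = j + t"
    "(True, p, i, c, q, j) \<in> set R" "srun R (hs @ ks) (q, j + t) w' b"
    by (auto elim: srun_ConsE)
  show ?case
  proof (cases "hs = []")
    case True
    have "srun R [h] a c (q, h)" using srun.Cons[OF r(4) srun.Nil] r by simp
    moreover have "srun R ks (q, h) w' b" using r True by simp
    ultimately show ?thesis using r True by auto
  next
    case False
    from Cons.IH[OF r(5) False] obtain q' u v where
      *: "srun R hs (q, j + t) u (q', last hs)" "srun R ks (q', last hs) v b" "w' = u + v"
      by blast
    have "srun R (h # hs) a (c + u) (q', last hs)" using srun.Cons[OF r(4) *(1)] r by simp
    then show ?thesis using * False r by (auto simp: add.assoc intro!: exI)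
  qed
qed simp

text \<open>Each step starts above \<open>m\<close>, hence above the threshold of its rule, so it
  has a unit of the counter to spare. No step starts at the last height, whence
  \<open>butlast\<close>; that height is positive because the last step keeps its spare
  unit.\<close>

lemma srun_lower:
  assumes "srun R hs (p, h) w (q, h')" "hs \<noteq> []" "h > m" "\<forall>x\<in>set (butlast hs). x > m"
    and "\<forall>(s, p, i, c, q, j)\<in>set R. i \<le> m"
  shows "h' > 0 \<and> (\<exists>ks. length ks = length hs \<and> srun R ks (p, h - 1) w (q, h' - 1))"
  using assms(1-4)
proof (induction hs arbitrary: p h w)
  case (Cons x hs)
  from Cons.prems(1) obtain i c q' j t w' where r: "h = i + t" "w = c + w'" "x = j + t"
    "(True, p, i, c, q', j) \<in> set R" "srun R hs (q', j + t) w' (q, h')"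
    by (auto elim: srun_ConsE)
  have "i \<le> m" using assms(5) r(4) by auto
  with Cons.prems r obtain t' where t: "t = Suc t'" by (cases t) auto
  have step: "srun R ks (q', j + t') w' b \<Longrightarrow> srun R ((j + t') # ks) (p, i + t') w b" for ks b
    using srun.Cons[OF r(4)] r(2) by blast
  show ?case
  proof (cases "hs = []")
    case True
    with r(5) have "q = q'" "h' = j + t" "w' = 0" by (auto elim: srun_NilE)
    then have "srun R [j + t'] (p, h - 1) w (q, h' - 1)" using step[of "[]"] t r(1)
      by (auto intro: srun.Nil)
    then show ?thesis using True t \<open>h' = j + t\<close> by (auto intro!: exI[of _ "[j + t']"])
  next
    case False
    then have "h' > 0 \<and> (\<exists>ks. length ks = length hs \<and> srun R ks (q', x - 1) w' (q, h' - 1))"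
      using Cons.IH[of q' x w'] Cons.prems r by auto
    then obtain ks where "h' > 0" "length ks = length hs" "srun R ks (q', j + t') w' (q, h' - 1)"
      using t r(3) by auto
    then show ?thesis using step t r(1) by (auto intro!: exI[of _ "(j + t') # ks"])
  qed
qed simp

text \<open>\<open>item_acc a\<close> is to derive the costs of paths from \<open>a\<close> to the
  accepting configuration, and \<open>item_run a b\<close> those of paths from \<open>a\<close> to
  \<open>b\<close> that can be raised by any amount. \<open>Suc\<close> keeps both apart from
  nonterminal \<open>0\<close>.\<close>

definition item_acc :: "'q::bcode \<times> nat \<Rightarrow> nat" where
  "item_acc a = Suc (encode (0 :: nat, encode a))"

definition item_run :: "'q::bcode \<times> nat \<Rightarrow> 'q \<times> nat \<Rightarrow> nat" where
  "item_run a b = Suc (encode (1 :: nat, encode (a, b)))"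

lemma item_inject [simp]:
  "item_acc a = item_acc b \<longleftrightarrow> a = b" "item_run a b = item_run a' b' \<longleftrightarrow> a = a' \<and> b = b'"
  "item_acc a \<noteq> item_run b b'" "item_run b b' \<noteq> item_acc a" "item_acc a \<noteq> 0" "item_run a b \<noteq> 0"
  "0 \<noteq> item_acc a" "0 \<noteq> item_run a b"
  by (simp_all add: item_acc_def item_run_def del: encode_nat_def)

text \<open>Any common bound on the heights in the rules will do; a sum is directly
  computable.\<close>

definition max_height :: "'q mrule list \<Rightarrow> nat" where
  "max_height R = sum_list (map (\<lambda>r. fst (snd (snd r)) + snd (snd (snd (snd (snd r))))) R)"

text \<open>The factor two ensures that a run whose first step ends above the bound has started
  above \<open>max_height R\<close>, where it can be lowered.\<close>

definition configs :: "'q mrule list \<Rightarrow> ('q \<times> nat) list" where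
  "configs R = concat (map (\<lambda>p. map (\<lambda>i. (p, i)) [0..<Suc (max_height R + max_height R)])
     (map (\<lambda>r. fst (snd r)) R @ map (\<lambda>r. fst (snd (snd (snd (snd r))))) R))"

text \<open>The triple construction for pushdown automata. In order, the rules stop at
  \<open>acc\<close>, begin with a liftable run, join two runs, raise a run by one unit, and take a
  single rule of the machine. Raising stands in for the matching of push and pop, so that items of
  bounded height suffice.\<close>

definition grammar :: "'q::bcode mrule list \<Rightarrow> 'q \<times> nat \<Rightarrow> wrule list" where
  "grammar R acc =
     (item_acc acc, 0, 0, 0) #
     concat (map (\<lambda>a. map (\<lambda>b. (item_acc a, 0, item_run a b, item_acc b)) (configs R)) (configs R)) @
     concat (map (\<lambda>a. concat (map (\<lambda>b. map (\<lambda>d. (item_run a d, 0, item_run a b, item_run b d))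
       (configs R)) (configs R))) (configs R)) @
     concat (map (\<lambda>a. map (\<lambda>b. (item_run (fst a, Suc (snd a)) (fst b, Suc (snd b)), 0,
       item_run a b, 0)) (configs R)) (configs R)) @
     concat (map (\<lambda>r. if fst r
       then map (\<lambda>t. (item_run (fst (snd r), fst (snd (snd r)) + t)
           (fst (snd (snd (snd (snd r)))), snd (snd (snd (snd (snd r)))) + t),
           fst (snd (snd (snd r))), 0, 0)) [0..<Suc (max_height R + max_height R)]
       else [(item_acc (fst (snd r), fst (snd (snd r))), fst (snd (snd (snd r))),
           item_acc (fst (snd (snd (snd (snd r)))), snd (snd (snd (snd (snd r))))), 0)]) R)"

lemma grammar_iff:
  "(x, w, y, z) \<in> set (grammar R acc) \<longleftrightarrow>
     (x = item_acc acc \<and> w = 0 \<and> y = 0 \<and> z = 0) \<or>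
     (\<exists>a\<in>set (configs R). \<exists>b\<in>set (configs R).
        x = item_acc a \<and> w = 0 \<and> y = item_run a b \<and> z = item_acc b) \<or>
     (\<exists>a\<in>set (configs R). \<exists>b\<in>set (configs R). \<exists>d\<in>set (configs R).
        x = item_run a d \<and> w = 0 \<and> y = item_run a b \<and> z = item_run b d) \<or>
     (\<exists>a\<in>set (configs R). \<exists>b\<in>set (configs R).
        x = item_run (fst a, Suc (snd a)) (fst b, Suc (snd b)) \<and> w = 0 \<and> y = item_run a b \<and> z = 0) \<or>
     (\<exists>p i q j. (False, p, i, w, q, j) \<in> set R \<and>
        x = item_acc (p, i) \<and> y = item_acc (q, j) \<and> z = 0) \<or>
     (\<exists>p i q j t. (True, p, i, w, q, j) \<in> set R \<and> t \<le> 2 * max_height R \<and>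
        x = item_run (p, i + t) (q, j + t) \<and> y = 0 \<and> z = 0)" (is "_ \<longleftrightarrow> ?rhs")
proof -
  let ?C = "set (configs R)" and ?N = "2 * max_height R"
  have rules: "(\<exists>r\<in>set R. (x, w, y, z) \<in> set (if fst r
       then map (\<lambda>t. (item_run (fst (snd r), fst (snd (snd r)) + t)
           (fst (snd (snd (snd (snd r)))), snd (snd (snd (snd (snd r)))) + t),
           fst (snd (snd (snd r))), 0, 0)) [0..<Suc (max_height R + max_height R)]
       else [(item_acc (fst (snd r), fst (snd (snd r))), fst (snd (snd (snd r))),
           item_acc (fst (snd (snd (snd (snd r)))), snd (snd (snd (snd (snd r))))), 0)])) \<longleftrightarrow>
     (\<exists>p i q j. (False, p, i, w, q, j) \<in> set R \<and>
        x = item_acc (p, i) \<and> y = item_acc (q, j) \<and> z = 0) \<or>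
     (\<exists>p i q j t. (True, p, i, w, q, j) \<in> set R \<and> t \<le> ?N \<and>
        x = item_run (p, i + t) (q, j + t) \<and> y = 0 \<and> z = 0)" (is "?L \<longleftrightarrow> ?A \<or> ?B")
  proof
    assume ?L
    then obtain r where r: "r \<in> set R" "(x, w, y, z) \<in> set (if fst r
       then map (\<lambda>t. (item_run (fst (snd r), fst (snd (snd r)) + t)
           (fst (snd (snd (snd (snd r)))), snd (snd (snd (snd (snd r)))) + t),
           fst (snd (snd (snd r))), 0, 0)) [0..<Suc (max_height R + max_height R)]
       else [(item_acc (fst (snd r), fst (snd (snd r))), fst (snd (snd (snd r))),
           item_acc (fst (snd (snd (snd (snd r)))), snd (snd (snd (snd (snd r))))), 0)])" ..
    obtain s p i c q j where s: "r = (s, p, i, c, q, j)" by (cases r)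
    show "?A \<or> ?B"
    proof (cases s)
      case True
      with r(2) s obtain t where "t \<le> ?N" "x = item_run (p, i + t) (q, j + t)" "w = c" "y = 0" "z = 0"
        by (auto simp del: upt_Suc)
      with True r(1) s have "(True, p, i, w, q, j) \<in> set R" by simp
      with \<open>t \<le> ?N\<close> \<open>x = _\<close> \<open>y = 0\<close> \<open>z = 0\<close> show ?thesis by blast
    qed (use r s in auto)
  next
    assume "?A \<or> ?B"
    then show ?L
    proof (elim disjE exE conjE)
      fix p i q j
      assume "(False, p, i, w, q, j) \<in> set R" "x = item_acc (p, i)" "y = item_acc (q, j)" "z = 0"
      then show ?L by (intro bexI[of _ "(False, p, i, w, q, j)"]) auto
    next
      fix p i q j t
      assume "(True, p, i, w, q, j) \<in> set R" "t \<le> ?N" "x = item_run (p, i + t) (q, j + t)"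
        "y = 0" "z = 0"
      then show ?L
        by (intro bexI[of _ "(True, p, i, w, q, j)"]) (auto simp del: upt_Suc)
    qed
  qed
  show ?thesis
    unfolding grammar_def list.set set_append set_concat set_map insert_iff Un_iff UN_iff image_iff
      bex_simps rules by simp
qed

lemma max_height_ge:
  assumes "(s, p, i, c, q, j) \<in> set R"
  shows "i \<le> max_height R" "j \<le> max_height R"
proof -
  have "i + j \<le> max_height R"
    unfolding max_height_def using assms by (intro member_le_sum_list) (force, simp)
  then show "i \<le> max_height R" "j \<le> max_height R" by auto
qed

lemma configs_iff:
  "(p, i) \<in> set (configs R) \<longleftrightarrow> i \<le> 2 * max_height R \<and>
     (\<exists>s i c q j. (s, p, i, c, q, j) \<in> set R \<or> (s, q, j, c, p, i) \<in> set R)"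
  unfolding configs_def
  by (auto simp del: upt_Suc simp: less_Suc_eq_le image_iff) force+

text \<open>The quantifier over \<open>t\<close> is what the raising rules need: run items are built
  from shift rules alone, so each of their paths survives a translation.\<close>

lemma grammar_sound:
  fixes R :: "'q :: bcode mrule list"
  assumes "derives (grammar R acc) x w"
  shows "(x = 0 \<longrightarrow> w = 0) \<and> (\<forall>a. x = item_acc a \<longrightarrow> mpath R a w acc) \<and>
    (\<forall>p i q j t. x = item_run (p, i) (q, j) \<longrightarrow> mpath R (p, i + t) w (q, j + t))"
  using assms
proof induction
  case (rule x c y z u v)
  from rule.hyps(1) show ?case
    unfolding grammar_iff
  proof (elim disjE exE bexE conjE)
    fix a b :: "'q \<times> nat" assume *: "x = item_acc a" "c = 0" "y = item_run a b" "z = item_acc b"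
    obtain p i q j where ab: "a = (p, i)" "b = (q, j)" by (cases a; cases b) auto
    have "mpath R a u b"
      using rule.IH(1)[THEN conjunct2, THEN conjunct2, rule_format, of p i q j 0] * ab by simp
    moreover have "mpath R b v acc" using rule.IH(2) * by simp
    ultimately have "mpath R a (u + v) acc" by (rule mpath_trans)
    then show ?thesis by (simp add: *)
  next
    fix a b d :: "'q \<times> nat" assume *: "x = item_run a d" "c = 0" "y = item_run a b" "z = item_run b d"
    obtain p i q j p' i' where ab: "a = (p, i)" "b = (q, j)" "d = (p', i')"
      by (cases a; cases b; cases d) auto
    have "mpath R (p, i + t) (u + v) (p', i' + t)" for t
    proof (rule mpath_trans)
      show "mpath R (p, i + t) u (q, j + t)" "mpath R (q, j + t) v (p', i' + t)"
        using rule.IH[THEN conjunct2, THEN conjunct2, rule_format] * ab by simp_all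
    qed
    then show ?thesis by (simp add: * ab)
  next
    fix a b :: "'q \<times> nat"
    assume *: "x = item_run (fst a, Suc (snd a)) (fst b, Suc (snd b))" "c = 0"
      "y = item_run a b" "z = 0"
    have "v = 0" using rule.IH(2) * by simp
    moreover have t: "mpath R (fst a, snd a + t) u (fst b, snd b + t)" for t
      using rule.IH(1)[THEN conjunct2, THEN conjunct2, rule_format, of "fst a" "snd a" "fst b" "snd b"] *
      by simp
    ultimately show ?thesis using t[of "Suc _"] by (simp add: *)
  next
    fix p i q j assume *: "(False, p, i, c, q, j) \<in> set R" "x = item_acc (p, i)"
      "y = item_acc (q, j)" "z = 0"
    have "v = 0" "mpath R (q, j) u acc" using rule.IH * by simp_all
    then show ?thesis using mpath.exact[OF *(1)] by (simp add: *)
  next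
    fix p i q j t assume *: "(True, p, i, c, q, j) \<in> set R" "x = item_run (p, i + t) (q, j + t)"
      "y = 0" "z = 0"
    have "u = 0" "v = 0" using rule.IH * by simp_all
    moreover have "mpath R (p, i + (t + t')) (c + 0) (q, j + (t + t'))" for t'
      by (rule mpath.shift[OF *(1) mpath.refl])
    ultimately show ?thesis by (simp add: * add.assoc)
  qed (use rule.IH in \<open>simp add: mpath.refl\<close>)
qed simp

text \<open>The states at the ends of a nonempty run occur in rules; so an end of low height lies in
  \<open>configs\<close>.\<close>

lemma srun_ends:
  assumes "srun R hs (p, h) w (q, h')" "hs \<noteq> []"
  shows "\<exists>i c r j. (True, p, i, c, r, j) \<in> set R" "\<exists>r i c j. (True, r, i, c, q, j) \<in> set R"
    "h' = last hs"
proof -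
  have "hs \<noteq> [] \<longrightarrow> (\<exists>i c r j. (True, fst a, i, c, r, j) \<in> set R) \<and>
      (\<exists>r i c j. (True, r, i, c, fst b, j) \<in> set R) \<and> snd b = last hs" if "srun R hs a w b" for a b
    using that
  proof induction
    case (Cons p i c q j hs t w a)
    show ?case
    proof (cases "hs = []")
      case True
      with Cons.hyps(2) have "a = (q, j + t)" by (auto elim: srun_NilE)
      with True Cons.hyps(1) show ?thesis by auto
    qed (use Cons in auto)
  qed simp
  from this[OF assms(1)] assms(2) show "\<exists>i c r j. (True, p, i, c, r, j) \<in> set R"
    "\<exists>r i c j. (True, r, i, c, q, j) \<in> set R" "h' = last hs" by auto
qed

lemma derives_grammar_rule:
  "(x, c, y, z) \<in> set (grammar R acc) \<Longrightarrow> derives (grammar R acc) y u \<Longrightarrow>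
    derives (grammar R acc) z v \<Longrightarrow> w = c + u + v \<Longrightarrow> derives (grammar R acc) x w"
  using derives.rule by blast

text \<open>A run is cut wherever it comes down to the height bound. A run that stays above the bound in
  between does not need its lowest level, so it can be lowered by one.\<close>

lemma grammar_complete_srun:
  assumes "srun R hs (p, h) w (q, h')" "hs \<noteq> []" "h \<le> 2 * max_height R" "h' \<le> 2 * max_height R"
  shows "derives (grammar R acc) (item_run (p, h) (q, h')) w"
  using assms
\<comment> \<open>Cutting leaves two shorter runs; lowering keeps the length and decreases
  \<open>h\<close>.\<close>
proof (induction "(length hs, h)" arbitrary: hs p h w q h' rule: wf_induct[OF wf_lex_prod[OF wf_less_than wf_less_than], case_names less])
  case less
  let ?G = "grammar R acc" and ?N = "2 * max_height R"
  note IH = less.hyps[rule_format, OF _ HOL.refl]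
  note ends = srun_ends[OF less.prems(1,2)]
  have conf: "(p, h) \<in> set (configs R)" "(q, h') \<in> set (configs R)"
    using ends less.prems(3,4) unfolding configs_iff by blast+
  consider x where "hs = [x]" | us vs where "hs = us @ vs" "us \<noteq> []" "vs \<noteq> []" "last us \<le> ?N"
    | "length hs \<ge> 2" "\<forall>us vs. hs = us @ vs \<longrightarrow> us \<noteq> [] \<longrightarrow> vs \<noteq> [] \<longrightarrow> last us > ?N"
  proof (cases "\<exists>us vs. hs = us @ vs \<and> us \<noteq> [] \<and> vs \<noteq> [] \<and> last us \<le> ?N")
    case False
    with less.prems(2) that(1,3) show ?thesis by (cases hs; cases "tl hs") (auto simp: not_le)
  qed (use that(2) in blast)
  then show ?case
  proof cases
    case 1
    with less.prems(1) obtain i c j t where r: "h = i + t" "x = j + t" "w = c"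
      "(True, p, i, c, q, j) \<in> set R" "h' = x"
      by (auto elim!: srun_ConsE srun_NilE)
    then have "(item_run (p, h) (q, h'), c, 0, 0) \<in> set ?G"
      unfolding grammar_iff using less.prems(3)
      by (intro disjI2 exI[of _ p] exI[of _ i] exI[of _ q] exI[of _ j] exI[of _ t]) auto
    then show ?thesis by (rule derives_grammar_rule[OF _ derives.unit derives.unit]) (simp add: r)
  next
    case 2
    obtain r u v where s: "srun R us (p, h) u (r, last us)" "srun R vs (r, last us) v (q, h')"
      "w = u + v"
      using srun_append less.prems(1) 2 by metis
    have d: "derives ?G (item_run (p, h) (r, last us)) u"
      "derives ?G (item_run (r, last us) (q, h')) v"
      by (rule IH[OF _ s(1)]; use 2 less.prems in auto) (rule IH[OF _ s(2)]; use 2 less.prems in auto)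
    have "(r, last us) \<in> set (configs R)"
      using srun_ends[OF s(1) 2(2)] 2(4) unfolding configs_iff by blast
    with conf have "(item_run (p, h) (q, h'), 0, item_run (p, h) (r, last us),
        item_run (r, last us) (q, h')) \<in> set ?G"
      unfolding grammar_iff by blast
    then show ?thesis using d by (rule derives_grammar_rule) (simp add: s(3))
  next
    case 3
    have high: "x > ?N" if x: "x \<in> set (butlast hs)" for x
    proof -
      obtain k where k: "k < length hs - 1" "x = hs ! k"
        using x by (metis in_set_conv_nth length_butlast nth_butlast)
      have "last (take (Suc k) hs) = x" using k by (simp add: take_Suc_conv_app_nth)
      moreover have "hs = take (Suc k) hs @ drop (Suc k) hs" by simp
      moreover have "take (Suc k) hs \<noteq> []" "drop (Suc k) hs \<noteq> []" using k by auto
      ultimately show ?thesis using 3(2) by metis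
    qed
    obtain x y ks where hs: "hs = x # y # ks" using 3(1) by (cases hs; cases "tl hs") auto
    from less.prems(1)[unfolded hs] obtain i c r j t where r: "h = i + t" "x = j + t"
      "(True, p, i, c, r, j) \<in> set R" by (auto elim: srun_ConsE)
    \<comment> \<open>\<open>x = j + t\<close> exceeds \<open>2 * max_height R\<close> and
      \<open>j\<close> is at most \<open>max_height R\<close>; so \<open>t\<close>, and with it
      \<open>h = i + t\<close>, exceeds \<open>max_height R\<close>.\<close>
    have "x > ?N" using high hs by simp
    then have "h > max_height R" using r max_height_ge[OF r(3)] by linarith
    moreover have "\<forall>x\<in>set (butlast hs). x > max_height R" using high by fastforce
    moreover have "\<forall>(s, p, i, c, q, j)\<in>set R. i \<le> max_height R" using max_height_ge by fast
    ultimately obtain ks where ks: "h' > 0" "length ks = length hs"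
      "srun R ks (p, h - 1) w (q, h' - 1)"
      using srun_lower[OF less.prems(1,2)] by blast
    have "h > 0" using \<open>h > max_height R\<close> by simp
    have d: "derives ?G (item_run (p, h - 1) (q, h' - 1)) w"
    proof (rule IH)
      show "((length ks, h - 1), (length hs, h)) \<in> less_than <*lex*> less_than"
        using ks(2) \<open>h > 0\<close> by simp
      show "ks \<noteq> []" using ks(2) hs by auto
    qed (use ks less.prems in auto)
    have "(p, h - 1) \<in> set (configs R)" "(q, h' - 1) \<in> set (configs R)"
      using conf unfolding configs_iff by auto
    then have "(item_run (p, h) (q, h'), 0, item_run (p, h - 1) (q, h' - 1), 0) \<in> set ?G"
      unfolding grammar_iff using \<open>h > 0\<close> \<open>h' > 0\<close>
      by (auto intro!: bexI[of _ "(p, h - 1)"] bexI[of _ "(q, h' - 1)"])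
    then show ?thesis using d derives.unit by (rule derives_grammar_rule) simp
  qed
qed

text \<open>The derivations are built at low heights only, but a path may climb by shift rules
  between tests. So the induction over the path keeps a pending run to some low configuration
  \<open>b\<close>, and closes it when an exact rule, whose heights are low, is put in
  front.\<close>

lemma grammar_complete:
  assumes "mpath R (p, i) w acc" "i \<le> 2 * max_height R" "snd acc \<le> 2 * max_height R"
  shows "derives (grammar R acc) (item_acc (p, i)) w"
proof -
  let ?G = "grammar R acc" and ?N = "2 * max_height R"
  have close: "derives ?G (item_acc a) (u + v)"
    if "srun R hs a u b" "derives ?G (item_acc b) v" "snd a \<le> ?N" "snd b \<le> ?N" for a b hs u v
  proof (cases "hs = []")
    case True
    with that show ?thesis by (auto elim: srun_NilE)
  next
    case False
    obtain p i q j where ab: "a = (p, i)" "b = (q, j)" by (cases a; cases b) auto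
    note ends = srun_ends[OF that(1)[unfolded ab] False]
    have "a \<in> set (configs R)" "b \<in> set (configs R)"
      using ends that(3,4) unfolding configs_iff ab snd_conv by blast+
    then have "(item_acc a, 0, item_run a b, item_acc b) \<in> set ?G"
      unfolding grammar_iff by blast
    moreover have "derives ?G (item_run a b) u"
      using grammar_complete_srun[of R hs p i u q j] that False ab by simp
    ultimately show ?thesis using that(2) by (rule derives_grammar_rule) simp
  qed
  have "\<exists>hs b u v. srun R hs a u b \<and> derives ?G (item_acc b) v \<and> snd b \<le> ?N \<and> w = u + v"
    if "mpath R a w a'" "a' = acc" for a a' w
    using that
  proof induction
    case (refl a)
    have "derives ?G (item_acc acc) 0"
      by (rule derives_grammar_rule[OF _ derives.unit derives.unit]) (auto simp: grammar_iff)
    then show ?case using refl assms(3) srun.Nil[of R acc] by fastforce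
  next
    case (exact p i c q j w a)
    then obtain hs b u v where *: "srun R hs (q, j) u b" "derives ?G (item_acc b) v"
      "snd b \<le> ?N" "w = u + v" by blast
    have w: "derives ?G (item_acc (q, j)) w"
      using close[OF *(1,2)] *(3,4) max_height_ge[OF exact.hyps(1)] by simp
    have "(item_acc (p, i), c, item_acc (q, j), 0) \<in> set ?G"
      unfolding grammar_iff using exact.hyps(1) by blast
    from derives.rule[OF this w derives.unit] have "derives ?G (item_acc (p, i)) (c + w)" by simp
    moreover have "i \<le> ?N" using max_height_ge[OF exact.hyps(1)] by simp
    ultimately show ?case using srun.Nil[of R "(p, i)"] by fastforce
  next
    case (shift p i c q j t w a)
    then obtain hs b u v where *: "srun R hs (q, j + t) u b" "derives ?G (item_acc b) v"
      "snd b \<le> ?N" "w = u + v" by blast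
    have "srun R ((j + t) # hs) (p, i + t) (c + u) b"
      by (rule srun.Cons[OF shift.hyps(1) *(1)])
    then show ?case using * by (metis add.assoc)
  qed
  from this[OF assms(1) HOL.refl] obtain hs b u v where "srun R hs (p, i) u b"
    "derives ?G (item_acc b) v" "snd b \<le> ?N" "w = u + v" by blast
  then show ?thesis using close[of hs "(p, i)" u b v] assms(2) by simp
qed

lemma nonneg_mpath_iff:
  "(\<forall>w. mpath R (p, 0) w (q, 0) \<longrightarrow> 0 \<le> w) \<longleftrightarrow>
     (\<exists>W. nonneg_certificate (grammar R (q, 0)) (item_acc (p, 0)) W)"
proof -
  let ?G = "grammar R (q, 0)" and ?s = "item_acc (p, 0)"
  have "mpath R (p, 0) w (q, 0) \<longleftrightarrow> derives ?G ?s w" for w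
  proof
    assume "derives ?G ?s w"
    from grammar_sound[OF this, THEN conjunct2, THEN conjunct1, rule_format, OF HOL.refl]
    show "mpath R (p, 0) w (q, 0)" .
  qed (simp add: grammar_complete)
  then have "(\<forall>w. mpath R (p, 0) w (q, 0) \<longrightarrow> 0 \<le> w) \<longleftrightarrow> (\<forall>w. derives ?G ?s w \<longrightarrow> 0 \<le> w)"
    by simp
  also have "\<dots> \<longleftrightarrow> (\<exists>W. nonneg_certificate ?G ?s W)"
  proof
    assume "\<forall>w. derives ?G ?s w \<longrightarrow> 0 \<le> w"
    then show "\<exists>W. nonneg_certificate ?G ?s W" by (intro nonneg_certificate_complete) simp
  next
    assume "\<exists>W. nonneg_certificate ?G ?s W"
    then obtain W where "nonneg_certificate ?G ?s W" ..
    from nonneg_certificate_sound[OF this] show "\<forall>w. derives ?G ?s w \<longrightarrow> 0 \<le> w" by simp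
  qed
  finally show ?thesis .
qed

section \<open>Computability of the grammar\<close>

lemma computable_item_acc [computable]: "computable f \<Longrightarrow> computable (\<lambda>x. item_acc (f x))"
  unfolding item_acc_def by (intro computable)

lemma computable_item_run [computable]:
  "computable f \<Longrightarrow> computable g \<Longrightarrow> computable (\<lambda>x. item_run (f x) (g x))"
  unfolding item_run_def by (intro computable)

lemma computable_max_height [computable]:
  "computable R \<Longrightarrow> computable (\<lambda>x. max_height (R x))"
  unfolding max_height_def by (intro computable)

lemma computable_configs [computable]: "computable configs"
  unfolding configs_def by (intro computable)

lemma computable_grammar [computable]:
  assumes "computable R"
  shows "computable (\<lambda>x. grammar (R x) acc)"
proof (rule computable_compose[OF _ assms])
  note computable_configs' [computable] = computable_compose[OF computable_configs]
  show "computable (\<lambda>R. grammar R acc)"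
    unfolding grammar_def by (intro computable)
qed

section \<open>Products of two-by-two matrices\<close>

text \<open>The quadruple \<open>(a, b, c, d)\<close> is the matrix with rows \<open>(a, b)\<close> and \<open>(c, d)\<close>.\<close>

type_synonym mat4 = "zmax \<times> zmax \<times> zmax \<times> zmax"
type_synonym edge = "nat \<times> mat4 \<times> nat"

definition vmul :: "zmax \<times> zmax \<Rightarrow> mat4 \<Rightarrow> zmax \<times> zmax" where
  "vmul v M = (fst v * fst M + snd v * fst (snd (snd M)),
     fst v * fst (snd M) + snd v * snd (snd (snd M)))"

inductive reach :: "edge list \<Rightarrow> nat \<Rightarrow> zmax \<times> zmax \<Rightarrow> bool" for E where
  start: "reach E 0 (Fin 0, NegInf)"
| step: "reach E g v \<Longrightarrow> (g, M, g') \<in> set E \<Longrightarrow> reach E g' (vmul v M)"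

text \<open>Vertices \<open>0\<close> and \<open>1\<close> are the start and the end. The last
  matrix of a complete path will have - \<infinity> in its second column, so the value stands alone
  in the first entry.\<close>

definition negative_value :: "edge list \<Rightarrow> bool" where
  "negative_value E \<longleftrightarrow> (\<exists>z. z < Fin 0 \<and> reach E 1 (z, NegInf))"

definition vshift :: "int \<Rightarrow> zmax \<times> zmax \<Rightarrow> zmax \<times> zmax" where
  "vshift s v = (Fin s * fst v, Fin s * snd v)"

abbreviation dead :: "zmax \<times> zmax" where "dead \<equiv> (NegInf, NegInf)"

lemma vshift_vshift: "vshift s (vshift t v) = vshift (s + t) v"
proof -
  have "Fin s * (Fin t * x) = Fin (s + t) * x" for x by (cases x) auto
  then show ?thesis by (simp add: vshift_def)
qed

lemma vshift_0 [simp]: "vshift 0 v = v"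
proof -
  have "Fin 0 * x = x" for x by (cases x) auto
  then show ?thesis by (simp add: vshift_def)
qed

lemma vshift_dead [simp]: "vshift s dead = dead" by (simp add: vshift_def)

lemma vshift_eq_dead [simp]: "vshift s v = dead \<longleftrightarrow> v = dead"
  by (cases v; cases "fst v"; cases "snd v") (auto simp: vshift_def)

lemma vmul_vshift: "vmul (vshift s v) M = vshift s (vmul v M)"
  by (simp add: vmul_def vshift_def distrib_left mult.assoc)

lemma vmul_dead [simp]: "vmul dead M = dead"
  by (simp add: vmul_def plus_zmax_def)

text \<open>Machine states: \<open>(0, g, b)\<close> at height \<open>n\<close> is a vector at vertex \<open>g\<close> with two finite
  entries, where entry \<open>b\<close> exceeds the other one by \<open>n\<close>; \<open>(1, g, b)\<close> is a vector with the
  single finite entry \<open>b\<close>, and \<open>(2, g, 0)\<close> is the vector without finite entries. The cost of a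
  path is the smallest finite entry. The states \<open>(3 + e, encode q, j)\<close> empty the counter at cost
  \<open>e\<close> per unit and then move to \<open>(q, j)\<close>; \<open>(5, 0, 0)\<close> is accepting.\<close>

type_synonym mstate = "nat \<times> nat \<times> nat"

definition vec_of :: "mstate \<Rightarrow> nat \<Rightarrow> zmax \<times> zmax" where
  "vec_of p n =
     (if fst p = 0 then
        (if snd (snd p) = 0 then (Fin (int n), Fin 0) else (Fin 0, Fin (int n)))
      else if fst p = 1 then
        (if snd (snd p) = 0 then (Fin 0, NegInf) else (NegInf, Fin 0))
      else dead)"

definition norm_vec :: "nat \<Rightarrow> zmax \<times> zmax \<Rightarrow> mstate \<times> nat \<times> int" where
  "norm_vec g v =
     (case fst v of
        NegInf \<Rightarrow> (case snd v of NegInf \<Rightarrow> ((2, g, 0), 0, 0) | Fin y \<Rightarrow> ((1, g, 1), 0, y))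
      | Fin x \<Rightarrow> (case snd v of NegInf \<Rightarrow> ((1, g, 0), 0, x)
          | Fin y \<Rightarrow> if y \<le> x then ((0, g, 0), nat (x - y), y) else ((0, g, 1), nat (y - x), x)))"

definition canonical :: "mstate \<Rightarrow> nat \<Rightarrow> bool" where
  "canonical p n \<longleftrightarrow> fst p = 0 \<and> snd (snd p) \<le> 1 \<or> fst p = 1 \<and> snd (snd p) \<le> 1 \<and> n = 0 \<or>
     fst p = 2 \<and> snd (snd p) = 0 \<and> n = 0"

lemma norm_vec:
  assumes "norm_vec g v = (p, n, s)"
  shows "vshift s (vec_of p n) = v" "fst (snd p) = g" "canonical p n"
proof -
  obtain x y where v: "v = (x, y)" by (cases v)
  show "vshift s (vec_of p n) = v" "fst (snd p) = g" "canonical p n"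
    using assms unfolding v
    by (cases x; cases y; auto simp: norm_vec_def vshift_def vec_of_def canonical_def
        split: if_splits)+
qed

text \<open>The dead vector absorbs every shift, so its normal form cannot record one.\<close>

lemma norm_vec_vshift:
  assumes "norm_vec g v = (p, n, c)" "v \<noteq> dead"
  shows "norm_vec g (vshift s v) = (p, n, s + c)"
proof -
  obtain x y where v: "v = (x, y)" by (cases v)
  show ?thesis
    using assms unfolding v
    by (cases x; cases y) (auto simp: norm_vec_def vshift_def split: if_splits)
qed

lemma norm_vec_dead [simp]: "norm_vec g dead = ((2, g, 0), 0, 0)"
  by (simp add: norm_vec_def)

section \<open>The effect of a matrix on a vector whose entries differ greatly\<close>

definition is_NegInf :: "zmax \<Rightarrow> bool" where
  "is_NegInf z = (case z of NegInf \<Rightarrow> True | Fin i \<Rightarrow> False)"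

definition zabs :: "zmax \<Rightarrow> nat" where
  "zabs z = (case z of NegInf \<Rightarrow> 0 | Fin i \<Rightarrow> nat \<bar>i\<bar>)"

text \<open>From this difference on, a finite coefficient of the larger entry decides each maximum.
  The \<open>Suc\<close> makes a growing column strictly exceed a constant one; with a tie at the
  threshold, \<open>norm_vec\<close> could name the wrong entry as the larger.\<close>

definition threshold :: "mat4 \<Rightarrow> nat" where
  "threshold M =
     Suc (zabs (fst M) + zabs (fst (snd M)) + zabs (fst (snd (snd M))) + zabs (snd (snd (snd M))))"

definition mrow :: "mat4 \<Rightarrow> nat \<Rightarrow> zmax \<times> zmax" where
  "mrow M b = (if b = 0 then (fst M, fst (snd M)) else (fst (snd (snd M)), snd (snd (snd M))))"

text \<open>How the entries of the product of a vector with matrix \<open>M\<close> depend on entry \<open>b\<close> of the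
  vector once it exceeds the other entry by \<open>threshold M\<close>: all grow with it (\<open>1\<close>), none does
  (\<open>0\<close>), or exactly one does while the other one stays finite (\<open>2\<close>).\<close>

definition slope :: "mat4 \<Rightarrow> nat \<Rightarrow> nat" where
  "slope M b =
     (if is_NegInf (fst (mrow M b)) \<and> is_NegInf (snd (mrow M b)) then 0
      else if (is_NegInf (fst (mrow M b)) \<longrightarrow> is_NegInf (fst (mrow M (1 - b)))) \<and>
        (is_NegInf (snd (mrow M b)) \<longrightarrow> is_NegInf (snd (mrow M (1 - b)))) then 1
      else 2)"

text \<open>For finite \<open>r\<close> and \<open>s\<close> the assumption gives
  \<open>k + r \<ge> s\<close>; so the first term attains the maximum, and the surplus
  \<open>t\<close> is merely added.\<close>

lemma big_entry:
  assumes "zabs r + zabs s \<le> k"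
  shows "Fin (int (k + t)) * r + Fin 0 * s =
    (if is_NegInf r then s else Fin (int t) * (Fin (int k) * r + s))"
  using assms
  by (cases r; cases s) (auto simp: plus_zmax_def max_def zabs_def is_NegInf_def)

lemma vmul_big:
  fixes M :: mat4 and b :: nat
  assumes "b \<le> 1"
  defines "r \<equiv> mrow M b" and "s \<equiv> mrow M (1 - b)" and "k \<equiv> threshold M"
  shows "vmul (vec_of (0, g, b) (k + t)) M =
    (if is_NegInf (fst r) then fst s else Fin (int t) * (Fin (int k) * fst r + fst s),
     if is_NegInf (snd r) then snd s else Fin (int t) * (Fin (int k) * snd r + snd s))"
proof -
  have k: "zabs (fst r) + zabs (fst s) \<le> k" "zabs (snd r) + zabs (snd s) \<le> k"
    using assms(1) by (auto simp: r_def s_def k_def threshold_def mrow_def)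
  have "vmul (vec_of (0, g, b) (k + t)) M =
    (Fin (int (k + t)) * fst r + Fin 0 * fst s, Fin (int (k + t)) * snd r + Fin 0 * snd s)"
    using assms(1) by (auto simp: vmul_def vec_of_def r_def s_def mrow_def add.commute)
  then show ?thesis using big_entry[OF k(1)] big_entry[OF k(2)] by simp
qed

lemma is_NegInf_iff: "is_NegInf z \<longleftrightarrow> z = NegInf"
  by (cases z) (auto simp: is_NegInf_def)

lemma zmax_times_0 [simp]: "Fin 0 * x = x"
  by (cases x) auto

text \<open>With slope 0 only the other entry contributes; with slope 1 every finite entry of the
  product gains \<open>t\<close>. Either way the result is a fixed vector up to a shift, so the
  counter can be given up at cost \<open>slope M b\<close> per unit.\<close>

lemma slope_uniform:
  assumes "b \<le> 1" "slope M b \<noteq> 2"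
  shows "vmul (vec_of (0, g, b) (threshold M + t)) M =
    vshift (int (slope M b * t)) (vmul (vec_of (0, g, b) (threshold M)) M)"
proof -
  obtain r0 r1 s0 s1 where rs: "mrow M b = (r0, r1)" "mrow M (1 - b) = (s0, s1)"
    by (cases "mrow M b"; cases "mrow M (1 - b)") auto
  have zero: "vmul (vec_of (0, g, b) (threshold M)) M =
    (if is_NegInf r0 then s0 else Fin (int (threshold M)) * r0 + s0,
     if is_NegInf r1 then s1 else Fin (int (threshold M)) * r1 + s1)"
    using vmul_big[OF assms(1), of g M 0] unfolding rs by simp
  consider "slope M b = 0" "r0 = NegInf" "r1 = NegInf"
    | "slope M b = 1" "r0 = NegInf \<longrightarrow> s0 = NegInf" "r1 = NegInf \<longrightarrow> s1 = NegInf"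
    using assms(2) unfolding slope_def rs is_NegInf_iff fst_conv snd_conv by (auto split: if_splits)
  then show ?thesis
    unfolding vmul_big[OF assms(1)] zero rs vshift_def is_NegInf_iff by cases auto
qed

text \<open>One entry grows with \<open>t\<close>, the other stays fixed and is smaller. So the
  difference grows by \<open>t\<close> while the smallest entry, which is the cost, does not change:
  one shift rule covers all large heights.\<close>

lemma slope_mixed:
  assumes "b \<le> 1" "slope M b = 2"
    and "norm_vec g' (vmul (vec_of (0, g, b) (threshold M)) M) = (q, j, c)"
  shows "norm_vec g' (vmul (vec_of (0, g, b) (threshold M + t)) M) = (q, j + t, c)"
proof -
  obtain r0 r1 s0 s1 where rs: "mrow M b = (r0, r1)" "mrow M (1 - b) = (s0, s1)"
    by (cases "mrow M b"; cases "mrow M (1 - b)") auto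
  have abs: "zabs r0 + zabs s1 < threshold M" "zabs r1 + zabs s0 < threshold M"
    using assms(1) rs by (auto simp: threshold_def mrow_def split: if_splits)
  have big: "\<exists>y. Fin (int k) * r + s = Fin y \<and> x < y"
    if "r \<noteq> NegInf" "zabs r + zabs (Fin x) < k" for r s x k
    using that by (cases r; cases s) (auto simp: zabs_def plus_zmax_def max_def)
  have zero: "vmul (vec_of (0, g, b) (threshold M)) M =
    (if is_NegInf r0 then s0 else Fin (int (threshold M)) * r0 + s0,
     if is_NegInf r1 then s1 else Fin (int (threshold M)) * r1 + s1)"
    using vmul_big[OF assms(1), of g M 0] unfolding rs by simp
  consider x where "r0 = NegInf" "r1 \<noteq> NegInf" "s0 = Fin x"
    | x where "r1 = NegInf" "r0 \<noteq> NegInf" "s1 = Fin x"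
    using assms(2) unfolding slope_def rs is_NegInf_iff fst_conv snd_conv
    by (cases s0; cases s1) (auto split: if_splits)
  then show ?thesis
  proof cases
    case 1
    then obtain y where y: "Fin (int (threshold M)) * r1 + s1 = Fin y" "x < y"
      using big abs(2) by metis
    show ?thesis
      using assms(3) 1 y unfolding vmul_big[OF assms(1)] zero rs is_NegInf_iff
      by (auto simp: norm_vec_def)
  next
    case 2
    then obtain y where y: "Fin (int (threshold M)) * r0 + s0 = Fin y" "x < y"
      using big abs(1) by metis
    show ?thesis
      using assms(3) 2 y unfolding vmul_big[OF assms(1)] zero rs is_NegInf_iff
      by (auto simp: norm_vec_def)
  qed
qed

section \<open>The one-counter machine of a graph\<close>

definition exact_rule :: "mat4 \<Rightarrow> nat \<Rightarrow> mstate \<Rightarrow> nat \<Rightarrow> mstate mrule" where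
  "exact_rule M g' p i =
     (False, p, i, snd (snd (norm_vec g' (vmul (vec_of p i) M))),
      fst (norm_vec g' (vmul (vec_of p i) M)), fst (snd (norm_vec g' (vmul (vec_of p i) M))))"

definition flush_state :: "nat \<Rightarrow> mstate \<times> nat \<times> int \<Rightarrow> mstate" where
  "flush_state e r = (3 + e, encode (fst r), fst (snd r))"

text \<open>In the uniform case the counter is surplus and is removed by a loop that charges the
  slope. The loop is left only by a rule that tests for height 0, so no part of the surplus survives
  or escapes its charge.\<close>

definition high_rules :: "nat \<Rightarrow> mat4 \<Rightarrow> mstate \<times> nat \<times> int \<Rightarrow> nat \<Rightarrow> mstate mrule list" where
  "high_rules g M r b =
     (if slope M b = 2 then [(True, (0, g, b), threshold M, snd (snd r), fst r, fst (snd r))]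
      else [(True, (0, g, b), threshold M, snd (snd r), flush_state (slope M b) r, 0),
        (True, flush_state (slope M b) r, 1, int (slope M b), flush_state (slope M b) r, 0),
        (False, flush_state (slope M b) r, 0, 0, fst r, fst (snd r))])"

definition edge_rules :: "edge \<Rightarrow> mstate mrule list" where
  "edge_rules e =
     [exact_rule (fst (snd e)) (snd (snd e)) (1, fst e, 0) 0,
      exact_rule (fst (snd e)) (snd (snd e)) (1, fst e, 1) 0,
      exact_rule (fst (snd e)) (snd (snd e)) (2, fst e, 0) 0] @
     map (exact_rule (fst (snd e)) (snd (snd e)) (0, fst e, 0)) [0..<threshold (fst (snd e))] @
     map (exact_rule (fst (snd e)) (snd (snd e)) (0, fst e, 1)) [0..<threshold (fst (snd e))] @
     high_rules (fst e) (fst (snd e)) (norm_vec (snd (snd e))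
       (vmul (vec_of (0, fst e, 0) (threshold (fst (snd e)))) (fst (snd e)))) 0 @
     high_rules (fst e) (fst (snd e)) (norm_vec (snd (snd e))
       (vmul (vec_of (0, fst e, 1) (threshold (fst (snd e)))) (fst (snd e)))) 1"

text \<open>The dead vector at vertex \<open>1\<close> stands for the value - \<infinity>, which is
  no finite cost; the loop of cost \<open>- 1\<close> makes the costs of accepting paths unbounded
  below instead.\<close>

definition accept_rules :: "mstate mrule list" where
  "accept_rules =
     [(False, (1, 1, 0), 0, 0, (5, 0, 0), 0),
      (False, (2, 1, 0), 0, - 1, (2, 1, 0), 0),
      (False, (2, 1, 0), 0, 0, (5, 0, 0), 0)]"

definition machine :: "edge list \<Rightarrow> mstate mrule list" where
  "machine E = concat (map edge_rules E) @ accept_rules"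

lemma machine_cases:
  assumes "(f, p, i, c, q, j) \<in> set (machine E)"
  obtains (low) g M g' where "(g, M, g') \<in> set E" "\<not> f" "fst p \<le> 2" "fst (snd p) = g"
      "norm_vec g' (vmul (vec_of p i) M) = (q, j, c)"
  | (mixed) g M g' b where "(g, M, g') \<in> set E" "f" "b \<le> 1" "slope M b = 2" "p = (0, g, b)"
      "i = threshold M" "norm_vec g' (vmul (vec_of p i) M) = (q, j, c)"
  | (uniform) g M g' b q' j' where "(g, M, g') \<in> set E" "f" "b \<le> 1" "slope M b \<noteq> 2"
      "p = (0, g, b)" "i = threshold M" "norm_vec g' (vmul (vec_of p i) M) = (q', j', c)"
      "q = (3 + slope M b, encode q', j')" "j = 0"
  | (pop) e q' j' where "f" "e \<le> 1" "p = (3 + e, encode (q' :: mstate), j')" "i = 1" "c = int e"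
      "q = p" "j = 0"
  | (flushed) e where "\<not> f" "e \<le> 1" "p = (3 + e, encode q, j)" "i = 0" "c = 0" "fst q \<le> 2"
  | (accept) "\<not> f" "(p, i, c, q, j) = ((1, 1, 0), 0, 0, (5, 0, 0), 0) \<or>
      (p, i, c, q, j) = ((2, 1, 0), 0, - 1, (2, 1, 0), 0) \<or>
      (p, i, c, q, j) = ((2, 1, 0), 0, 0, (5, 0, 0), 0)"
proof -
  have slope: "slope M b \<le> 1" if "slope M b \<noteq> 2" for M b
    using that by (auto simp: slope_def split: if_splits)
  have tag: "fst (fst (norm_vec g v)) \<le> 2" for g v
    using norm_vec(3)[of g v "fst (norm_vec g v)" "fst (snd (norm_vec g v))" "snd (snd (norm_vec g v))"]
    by (auto simp: canonical_def)
  show thesis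
  proof (cases "(f, p, i, c, q, j) \<in> set accept_rules")
    case True
    then have "(f, p, i, c, q, j) = (False, (1, 1, 0), 0, 0, (5, 0, 0), 0) \<or>
        (f, p, i, c, q, j) = (False, (2, 1, 0), 0, - 1, (2, 1, 0), 0) \<or>
        (f, p, i, c, q, j) = (False, (2, 1, 0), 0, 0, (5, 0, 0), 0)"
      unfolding accept_rules_def list.set insert_iff by simp
    then show thesis by (intro accept) blast+
  next
    case False
    with assms obtain e where "e \<in> set E" "(f, p, i, c, q, j) \<in> set (edge_rules e)"
      unfolding machine_def by auto
    moreover obtain g M g' where "e = (g, M, g')" by (cases e) 
    ultimately have edge: "(g, M, g') \<in> set E" "(f, p, i, c, q, j) \<in> set (edge_rules (g, M, g'))"
      by simp_all
    let ?r = "\<lambda>b. norm_vec g' (vmul (vec_of (0, g, b) (threshold M)) M)"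
    have exact: thesis if "(f, p, i, c, q, j) = exact_rule M g' p' i'" "fst p' \<le> 2" "fst (snd p') = g"
      for p' i'
      using that edge(1) by (intro low[of g M g']) (auto simp: exact_rule_def)
    have high: thesis if b: "(f, p, i, c, q, j) \<in> set (high_rules g M (?r b) b)" "b \<le> 1" for b
    proof -
    obtain q' j' c' where r: "?r b = (q', j', c')" by (cases "?r b")
    show thesis
    proof (cases "slope M b = 2")
      case True
      with b(1) r have "(f, p, i, c, q, j) = (True, (0, g, b), threshold M, c', q', j')"
        by (simp add: high_rules_def)
      with r show thesis by (intro mixed[OF edge(1) _ b(2) True]) simp_all
    next
      case False
      let ?q = "(3 + slope M b, encode q', j')"
      have "(f, p, i, c, q, j) = (True, (0, g, b), threshold M, c', ?q, 0) \<or>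
          (f, p, i, c, q, j) = (True, ?q, 1, int (slope M b), ?q, 0) \<or>
          (f, p, i, c, q, j) = (False, ?q, 0, 0, q', j')"
        using b(1) False unfolding high_rules_def r flush_state_def by simp
      then show thesis
      proof (elim disjE)
        assume "(f, p, i, c, q, j) = (True, (0, g, b), threshold M, c', ?q, 0)"
        then show thesis by (intro uniform[OF edge(1) _ b(2) False, of q' j']) (simp_all add: r)
      next
        assume "(f, p, i, c, q, j) = (True, ?q, 1, int (slope M b), ?q, 0)"
        then show thesis by (intro pop[OF _ slope[OF False], of q' j']) simp_all
      next
        assume *: "(f, p, i, c, q, j) = (False, ?q, 0, 0, q', j')"
        then have "fst q \<le> 2" using tag[of g' "vmul (vec_of (0, g, b) (threshold M)) M"] r by simp
        with * show thesis by (intro flushed[OF _ slope[OF False]]) simp_all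
      qed
    qed
    qed
    show thesis
      using edge(2)
      unfolding edge_rules_def set_append Un_iff fst_conv snd_conv set_map image_iff list.set
        insert_iff empty_iff
      by (elim disjE bexE FalseE) ((erule exact; simp) | (erule high; simp))+
  qed
qed

text \<open>In a flushing state the rest of the counter is still to be paid for.\<close>

definition represents :: "edge list \<Rightarrow> mstate \<Rightarrow> nat \<Rightarrow> int \<Rightarrow> bool" where
  "represents E p n s \<longleftrightarrow>
     (fst p \<le> 2 \<longrightarrow> reach E (fst (snd p)) (vshift s (vec_of p n))) \<and>
     (\<forall>e q j. e \<le> 1 \<longrightarrow> p = (3 + e, encode (q :: mstate), j) \<longrightarrow>
        fst q \<le> 2 \<and> reach E (fst (snd q)) (vshift (s + int (e * n)) (vec_of q j))) \<and>
     (fst p = 5 \<longrightarrow> (\<exists>z. z \<le> Fin s \<and> reach E 1 (z, NegInf)))"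

section \<open>Soundness of the simulation\<close>

lemma represents_low:
  "fst p \<le> 2 \<Longrightarrow> represents E p n s \<longleftrightarrow> reach E (fst (snd p)) (vshift s (vec_of p n))"
  by (auto simp: represents_def)

lemma represents_flush:
  assumes "e \<le> 1"
  shows "represents E (3 + e, encode (q :: mstate), j) n s \<longleftrightarrow>
     fst q \<le> 2 \<and> reach E (fst (snd q)) (vshift (s + int (e * n)) (vec_of q j))"
  using assms by (auto simp: represents_def simp del: split_paired_All)

lemma represents_accept:
  "represents E (5, 0, 0) n s \<longleftrightarrow> (\<exists>z. z \<le> Fin s \<and> reach E 1 (z, NegInf))"
  by (auto simp: represents_def)

lemma represents_exact:
  assumes "(False, p, i, c, q, j) \<in> set (machine E)" "represents E p i s"
  shows "represents E q j (s + c)"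
  using assms(1)
proof (cases rule: machine_cases)
  case (low g M g')
  have "reach E g' (vmul (vshift s (vec_of p i)) M)"
    using assms(2) low by (auto simp: represents_low intro: reach.step)
  moreover have "vmul (vshift s (vec_of p i)) M = vshift (s + c) (vec_of q j)"
    using norm_vec(1)[OF low(5)] by (simp add: vmul_vshift flip: vshift_vshift)
  ultimately show ?thesis
    using norm_vec(2,3)[OF low(5)] by (auto simp: represents_low canonical_def)
next
  case (flushed e)
  then show ?thesis using assms(2) by (simp add: represents_flush represents_low)
next
  case accept
  from accept(2) show ?thesis
  proof (elim disjE)
    assume "(p, i, c, q, j) = ((1, 1, 0), 0, 0, (5, 0, 0), 0)"
    with assms(2) show ?thesis
      by (auto simp: represents_low represents_accept vec_of_def vshift_def intro!: exI[of _ "Fin s"])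
  next
    \<comment> \<open>The loop lowers the cost while the value stays - \<infinity>; hence the
      inequality, rather than an equation, in the accepting clause of
      \<open>represents\<close>.\<close>
    assume "(p, i, c, q, j) = ((2, 1, 0), 0, - 1, (2, 1, 0), 0)"
    with assms(2) show ?thesis by (simp add: represents_low vec_of_def)
  next
    assume "(p, i, c, q, j) = ((2, 1, 0), 0, 0, (5, 0, 0), 0)"
    with assms(2) show ?thesis
      by (auto simp: represents_low represents_accept vec_of_def intro!: exI[of _ NegInf])
  qed
qed simp_all

text \<open>A uniform rule pays \<open>c\<close> at once and leaves \<open>slope M b * t\<close> as
  a debt, which \<open>represents\<close> adds to the shift of the stored target; each pop settles
  one unit of height.\<close>

lemma represents_shift:
  assumes "(True, p, i, c, q, j) \<in> set (machine E)" "represents E p (i + t) s"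
  shows "represents E q (j + t) (s + c)"
  using assms(1)
proof (cases rule: machine_cases)
  case (mixed g M g' b)
  have "reach E g' (vmul (vshift s (vec_of p (i + t))) M)"
    using assms(2) mixed by (auto simp: represents_low intro: reach.step)
  moreover have norm: "norm_vec g' (vmul (vec_of p (i + t)) M) = (q, j + t, c)"
    using slope_mixed mixed by simp
  then have "vmul (vshift s (vec_of p (i + t))) M = vshift (s + c) (vec_of q (j + t))"
    using norm_vec(1)[OF norm] by (simp add: vmul_vshift flip: vshift_vshift)
  ultimately show ?thesis
    using norm_vec(2,3)[OF norm] by (auto simp: represents_low canonical_def)
next
  case (uniform g M g' b q' j')
  have "reach E g' (vmul (vshift s (vec_of p (i + t))) M)"
    using assms(2) uniform by (auto simp: represents_low intro: reach.step)
  moreover have "vmul (vec_of p (i + t)) M = vshift (int (slope M b * t)) (vshift c (vec_of q' j'))"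
    using slope_uniform uniform norm_vec(1)[OF uniform(7)] by simp
  then have "vmul (vshift s (vec_of p (i + t))) M =
      vshift (s + c + int (slope M b * t)) (vec_of q' j')"
    by (simp add: vmul_vshift vshift_vshift algebra_simps)
  moreover have "slope M b \<le> 1"
    using uniform(4) by (auto simp: slope_def split: if_splits)
  ultimately show ?thesis
    using norm_vec(2,3)[OF uniform(7)] uniform(8,9) by (auto simp: represents_flush canonical_def)
next
  case (pop e q' j')
  from assms(2) show ?thesis
    unfolding pop(3-7) represents_flush[OF pop(2)] by (simp add: algebra_simps)
qed simp_all

lemma represents_mpath:
  assumes "mpath (machine E) a w b" "represents E (fst a) (snd a) s"
  shows "represents E (fst b) (snd b) (s + w)"
  using assms
proof (induction arbitrary: s)
  case (exact p i c q j w a)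
  then show ?case using represents_exact by (fastforce simp: add.assoc[symmetric])
next
  case (shift p i c q j t w a)
  then show ?case using represents_shift by (fastforce simp: add.assoc[symmetric])
qed simp

lemma machine_sound:
  assumes "mpath (machine E) ((1, 0, 0), 0) w ((5, 0, 0), 0)" "w < 0"
  shows "negative_value E"
proof -
  have "represents E (1, 0, 0) 0 0"
    by (simp add: represents_low vec_of_def reach.start)
  then have "represents E (5, 0, 0) 0 w" using represents_mpath[OF assms(1), of 0] by simp
  then obtain z where "z \<le> Fin w" "reach E 1 (z, NegInf)" by (auto simp: represents_accept)
  moreover have "Fin w < Fin 0" using assms(2) by (simp add: less_zmax_def)
  ultimately show ?thesis unfolding negative_value_def using le_less_trans by blast
qed

section \<open>Completeness of the simulation\<close>

lemma edge_rules_machine: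
  "e \<in> set E \<Longrightarrow> r \<in> set (edge_rules e) \<Longrightarrow> r \<in> set (machine E)"
  by (auto simp: machine_def)

lemma exact_rule_machine:
  assumes "(g, M, g') \<in> set E" "canonical p n" "fst (snd p) = g" "fst p = 0 \<longrightarrow> n < threshold M"
  shows "exact_rule M g' p n \<in> set (machine E)"
proof -
  obtain a b where p: "p = (a, g, b)" using assms(3) by (cases p) auto
  have "b = 0 \<or> b = 1" "a = 0 \<or> a = 1 \<or> a = 2" using assms(2) p by (auto simp: canonical_def)
  then have "exact_rule M g' p n \<in> set (edge_rules (g, M, g'))"
    using assms(2,4) p unfolding edge_rules_def canonical_def by auto
  then show ?thesis using edge_rules_machine assms(1) by blast
qed

lemma high_rules_machine:
  assumes "(g, M, g') \<in> set E" "b \<le> 1"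
  shows "set (high_rules g M (norm_vec g' (vmul (vec_of (0, g, b) (threshold M)) M)) b)
    \<subseteq> set (machine E)"
proof -
  have "b = 0 \<or> b = 1" using assms(2) by auto
  then have "set (high_rules g M (norm_vec g' (vmul (vec_of (0, g, b) (threshold M)) M)) b)
    \<subseteq> set (edge_rules (g, M, g'))"
    unfolding edge_rules_def by auto
  then show ?thesis using edge_rules_machine assms(1) by blast
qed

lemma mpath_exact:
  "(False, p, i, c, q, j) \<in> set R \<Longrightarrow> mpath R (p, i) c (q, j)"
  using mpath.exact[OF _ mpath.refl] by fastforce

lemma mpath_shift:
  "(True, p, i, c, q, j) \<in> set R \<Longrightarrow> mpath R (p, i + t) c (q, j + t)"
  using mpath.shift[OF _ mpath.refl] by fastforce

lemma machine_simulates: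
  assumes "(g, M, g') \<in> set E" "canonical p n" "fst (snd p) = g"
    and norm: "norm_vec g' (vmul (vec_of p n) M) = (q, m, c)"
  shows "\<exists>c'. mpath (machine E) (p, n) c' (q, m) \<and> (vmul (vec_of p n) M \<noteq> dead \<longrightarrow> c' = c)"
proof (cases "fst p = 0 \<longrightarrow> n < threshold M")
  case True
  from exact_rule_machine[OF assms(1-3) True]
  have "mpath (machine E) (p, n) c (q, m)"
    by (intro mpath_exact) (simp add: exact_rule_def norm)
  then show ?thesis by blast
next
  case False
  then obtain b t where p: "p = (0, g, b)" "b \<le> 1" "n = threshold M + t"
    using assms(2,3) by (cases p) (auto simp: canonical_def not_less dest: le_Suc_ex)
  obtain q' j' c' where r: "norm_vec g' (vmul (vec_of (0, g, b) (threshold M)) M) = (q', j', c')"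
    by (cases "norm_vec g' (vmul (vec_of (0, g, b) (threshold M)) M)")
  note rules = high_rules_machine[OF assms(1) p(2), unfolded r high_rules_def]
  show ?thesis
  proof (cases "slope M b = 2")
    case True
    with rules have "(True, (0, g, b), threshold M, c', q', j') \<in> set (machine E)" by simp
    from mpath_shift[OF this, of t] slope_mixed[OF p(2) True r, of t] norm p
    show ?thesis by auto
  next
    case False
    let ?e = "slope M b" and ?q = "flush_state (slope M b) (q', j', c')"
    have "(True, (0, g, b), threshold M, c', ?q, 0) \<in> set (machine E)"
      and pop: "(True, ?q, 1, int ?e, ?q, 0) \<in> set (machine E)"
      and last: "(False, ?q, 0, 0, q', j') \<in> set (machine E)"
      using rules False by simp_all
    then have 1: "mpath (machine E) (p, n) c' (?q, t)"
      using mpath_shift[of "(0, g, b)" "threshold M" c' ?q 0 "machine E" t] p by simp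
    have 2: "mpath (machine E) (?q, t) (int (?e * t)) (?q, 0)"
    proof (induction t)
      case (Suc t)
      have "mpath (machine E) (?q, Suc t) (int ?e) (?q, t)" using mpath_shift[OF pop, of t] by simp
      from mpath_trans[OF this Suc] show ?case by (simp add: algebra_simps)
    qed (simp add: mpath.refl)
    have path: "mpath (machine E) (p, n) (c' + int (?e * t)) (q', j')"
      using mpath_trans[OF mpath_trans[OF 1 2] mpath_exact[OF last]] by simp
    have v: "vmul (vec_of p n) M =
        vshift (int (?e * t)) (vmul (vec_of (0, g, b) (threshold M)) M)"
      using slope_uniform[OF p(2) False, of g t] p by simp
    show ?thesis
    proof (cases "vmul (vec_of p n) M = dead")
      case True
      then show ?thesis using path v r norm by auto
    next
      case False
      then have "norm_vec g' (vmul (vec_of p n) M) = (q', j', int (?e * t) + c')"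
        using norm_vec_vshift[OF r] v by simp
      then show ?thesis using path norm by (auto simp: add.commute)
    qed
  qed
qed

text \<open>A path to a dead vector keeps the cost collected before, whereas \<open>norm_vec\<close>
  reports 0. So the cost is claimed for other vectors only, and \<open>machine_complete\<close>
  makes up for it by the loop.\<close>

lemma machine_reaches:
  assumes "reach E g v" "norm_vec g v = (p, n, s)"
  shows "\<exists>w. mpath (machine E) ((1, 0, 0), 0) w (p, n) \<and> (v \<noteq> dead \<longrightarrow> w = s)"
  using assms
proof (induction arbitrary: p n s)
  case start
  then show ?case by (auto simp: norm_vec_def intro!: exI[of _ 0] mpath.refl)
next
  case (step g v M g')
  obtain p' n' s' where norm: "norm_vec g v = (p', n', s')" by (cases "norm_vec g v")
  with step.IH obtain w where w: "mpath (machine E) ((1, 0, 0), 0) w (p', n')"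
    "v \<noteq> dead \<longrightarrow> w = s'" by blast
  obtain q m c where r: "norm_vec g' (vmul (vec_of p' n') M) = (q, m, c)"
    by (cases "norm_vec g' (vmul (vec_of p' n') M)")
  have v: "vmul v M = vshift s' (vmul (vec_of p' n') M)"
    using norm_vec(1)[OF norm] by (simp flip: vmul_vshift)
  obtain c' where c': "mpath (machine E) (p', n') c' (q, m)"
    "vmul (vec_of p' n') M \<noteq> dead \<longrightarrow> c' = c"
    using machine_simulates[OF step.hyps(2) norm_vec(3,2)[OF norm] r] by blast
  note path = mpath_trans[OF w(1) c'(1)]
  show ?case
  proof (cases "vmul v M = dead")
    case True
    then have "vmul (vec_of p' n') M = dead" using v vshift_eq_dead by metis
    then have "q = p" "m = n" using True r step.prems by simp_all
    then show ?thesis using path True by blast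
  next
    case False
    then have nd: "vmul (vec_of p' n') M \<noteq> dead" "v \<noteq> dead"
      using v vshift_dead vmul_dead by metis+
    from norm_vec_vshift[OF r nd(1), of s'] step.prems v
    have "q = p" "m = n" "s' + c = s" by simp_all
    then show ?thesis using path w(2) c'(2) nd by auto
  qed
qed

lemma machine_complete:
  assumes "negative_value E"
  shows "\<exists>w<0. mpath (machine E) ((1, 0, 0), 0) w ((5, 0, 0), 0)"
proof -
  from assms obtain z where z: "z < Fin 0" "reach E 1 (z, NegInf)"
    unfolding negative_value_def by blast
  have rules: "set accept_rules \<subseteq> set (machine E)" by (auto simp: machine_def)
  show ?thesis
  proof (cases z)
    case NegInf
    obtain w where w: "mpath (machine E) ((1, 0, 0), 0) w ((2, 1, 0), 0)"
      using machine_reaches[OF z(2)] NegInf by auto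
    have loop: "mpath (machine E) ((2, 1, 0), 0) (- int k) ((2, 1, 0), 0)" for k
    proof (induction k)
      case (Suc k)
      have "mpath (machine E) ((2, 1, 0), 0) (- 1) ((2, 1, 0), 0)"
        using rules by (intro mpath_exact) (auto simp: accept_rules_def)
      from mpath_trans[OF this Suc] show ?case by simp
    qed (simp add: mpath.refl)
    have "mpath (machine E) ((2, 1, 0), 0) 0 ((5, 0, 0), 0)"
      using rules by (intro mpath_exact) (auto simp: accept_rules_def)
    \<comment> \<open>\<open>nat (w + 1)\<close> turns of the loop bring any \<open>w\<close> below
      zero; a negative \<open>w\<close> takes none.\<close>
    from mpath_trans[OF mpath_trans[OF w loop[of "nat (w + 1)"]] this]
    show ?thesis by (intro exI[of _ "w - int (nat (w + 1))"]) auto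
  next
    case (Fin x)
    then have "norm_vec 1 (z, NegInf) = ((1, 1, 0), 0, x)" by (simp add: norm_vec_def)
    from machine_reaches[OF z(2) this] Fin
    have "mpath (machine E) ((1, 0, 0), 0) x ((1, 1, 0), 0)" by auto
    moreover have "mpath (machine E) ((1, 1, 0), 0) 0 ((5, 0, 0), 0)"
      using rules by (intro mpath_exact) (auto simp: accept_rules_def)
    ultimately have "mpath (machine E) ((1, 0, 0), 0) x ((5, 0, 0), 0)"
      using mpath_trans by fastforce
    moreover have "x < 0" using z(1) Fin by (simp add: less_zmax_def)
    ultimately show ?thesis by blast
  qed
qed

text \<open>A path is coded by a list of edge indices. Indices that do not continue the path are
  skipped, so every list of numbers denotes some path.\<close>

definition follow :: "edge list \<Rightarrow> nat list \<Rightarrow> nat \<times> zmax \<times> zmax" where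
  "follow E xs = foldl (\<lambda>s i.
     if i < length E \<and> fst (nth_default (0, (0, 0, 0, 0), 0) E i) = fst s
     then (snd (snd (nth_default (0, (0, 0, 0, 0), 0) E i)),
       vmul (snd s) (fst (snd (nth_default (0, (0, 0, 0, 0), 0) E i))))
     else s) (0, Fin 0, NegInf) xs"

lemma reach_iff_follow: "reach E g v \<longleftrightarrow> (\<exists>xs. follow E xs = (g, v))"
proof
  assume "reach E g v"
  then show "\<exists>xs. follow E xs = (g, v)"
  proof induction
    case start
    show ?case by (rule exI[of _ "[]"]) (simp add: follow_def)
  next
    case (step g v M g')
    then obtain xs where "follow E xs = (g, v)" by blast
    moreover obtain i where "i < length E" "E ! i = (g, M, g')"
      using step.hyps(2) unfolding in_set_conv_nth by blast
    ultimately have "follow E (xs @ [i]) = (g', vmul v M)"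
      by (simp add: follow_def nth_default_def)
    then show ?case by blast
  qed
next
  have "reach E (fst (follow E xs)) (snd (follow E xs))" for xs
  proof (induction xs rule: rev_induct)
    case Nil
    show ?case by (simp add: follow_def reach.start)
  next
    case (snoc i xs)
    show ?case
    proof (cases "i < length E \<and> fst (E ! i) = fst (follow E xs)")
      case True
      obtain g M g' where e: "E ! i = (g, M, g')" by (cases "E ! i")
      then have "(g, M, g') \<in> set E" using True nth_mem by metis
      moreover have "follow E (xs @ [i]) = (g', vmul (snd (follow E xs)) M)"
        using True e by (simp add: follow_def nth_default_def)
      ultimately show ?thesis using reach.step[OF snoc] True e by simp
    next
      case False
      then have "follow E (xs @ [i]) = follow E xs"
        by (auto simp: follow_def nth_default_def)
      with snoc show ?thesis by simp
    qed
  qed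
  then show "\<exists>xs. follow E xs = (g, v) \<Longrightarrow> reach E g v" by (metis fst_conv snd_conv)
qed

definition negative_path :: "edge list \<Rightarrow> nat list \<Rightarrow> bool" where
  "negative_path E xs \<longleftrightarrow> fst (follow E xs) = 1 \<and> is_NegInf (snd (snd (follow E xs))) \<and>
     (case fst (snd (follow E xs)) of NegInf \<Rightarrow> True | Fin x \<Rightarrow> x < 0)"

lemma negative_value_iff: "negative_value E \<longleftrightarrow> (\<exists>xs. negative_path E xs)"
proof -
  have "z < Fin 0 \<longleftrightarrow> (case z of NegInf \<Rightarrow> True | Fin x \<Rightarrow> x < 0)" for z
    by (cases z) (auto simp: less_zmax_def)
  then show ?thesis
    unfolding negative_value_def reach_iff_follow negative_path_def is_NegInf_iff
    by (metis fst_conv snd_conv prod.collapse)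
qed

section \<open>Computability of the machine and of the witnesses\<close>

lemma computable_vmul [computable]:
  assumes "computable v" "computable M"
  shows "computable (\<lambda>x. vmul (v x) (M x))"
  unfolding vmul_def by (intro computable assms)

lemma computable_vec_of [computable]:
  assumes "computable p" "computable n"
  shows "computable (\<lambda>x. vec_of (p x) (n x))"
  unfolding vec_of_def by (intro computable assms)

lemma computable_norm_vec [computable]:
  assumes "computable g" "computable v"
  shows "computable (\<lambda>x. norm_vec (g x) (v x))"
proof -
  have "computable (\<lambda>p. norm_vec (fst p) (snd p))"
    unfolding norm_vec_def by (intro computable)
  from computable_compose[OF this computable_Pair[OF assms]] show ?thesis by simp
qed

lemma computable_is_NegInf [computable]:
  "computable z \<Longrightarrow> computable (\<lambda>x. is_NegInf (z x))"
  unfolding is_NegInf_def by (intro computable)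

lemma computable_zabs [computable]: "computable z \<Longrightarrow> computable (\<lambda>x. zabs (z x))"
  unfolding zabs_def by (intro computable)

lemma computable_threshold [computable]:
  "computable M \<Longrightarrow> computable (\<lambda>x. threshold (M x))"
  unfolding threshold_def by (intro computable)

lemma computable_slope [computable]:
  assumes "computable M" "computable b"
  shows "computable (\<lambda>x. slope (M x) (b x))"
  unfolding slope_def mrow_def imp_conv_disj by (intro computable assms)

lemma computable_exact_rule [computable]:
  assumes "computable M" "computable g" "computable p" "computable i"
  shows "computable (\<lambda>x. exact_rule (M x) (g x) (p x) (i x))"
  unfolding exact_rule_def by (intro computable assms)

lemma computable_high_rules [computable]:
  assumes "computable g" "computable M" "computable r" "computable b"
  shows "computable (\<lambda>x. high_rules (g x) (M x) (r x) (b x))"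
  unfolding high_rules_def flush_state_def by (intro computable assms)

lemma computable_edge_rules: "computable edge_rules"
  unfolding edge_rules_def by (intro computable)

lemma computable_machine [computable]: "computable f \<Longrightarrow> computable (\<lambda>x. machine (f x))"
  unfolding machine_def
  by (intro computable computable_compose[OF computable_edge_rules])

lemma computable_negative_path [computable]:
  assumes "computable E" "computable xs"
  shows "computable (\<lambda>x. negative_path (E x) (xs x))"
proof -
  have follow: "computable (\<lambda>p. follow (fst p) (snd p))"
    unfolding follow_def by (intro computable)
  note [computable] = computable_compose[OF follow computable_Pair, simplified]
  show ?thesis unfolding negative_path_def by (intro computable assms)
qed

lemma ex_decode: "(\<exists>n. P (decode n)) \<longleftrightarrow> (\<exists>x. P x)"
  by (metis decode_encode)

lemma decidable_nonnegative_value: "decidable encode UNIV (\<lambda>E. \<not> negative_value E)"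
proof (rule decidable_semidecidable)
  let ?p = "(1, 0, 0) :: mstate" and ?q = "(5, 0, 0) :: mstate"
  let ?c = "\<lambda>x. nonneg_certificate (grammar (machine (fst x)) (?q, 0)) (item_acc (?p, 0))
    (decode (snd x))"
  let ?d = "\<lambda>x. negative_path (fst x) (decode (snd x))"
  show "computable ?c" "computable ?d" by (intro computable)+
  fix E
  have "\<not> negative_value E \<longleftrightarrow> (\<forall>w. mpath (machine E) (?p, 0) w (?q, 0) \<longrightarrow> 0 \<le> w)"
    using machine_sound[of E] machine_complete[of E] by (auto simp flip: not_less)
  also have "\<dots> \<longleftrightarrow> (\<exists>n. ?c (E, n))"
    unfolding nonneg_mpath_iff fst_conv snd_conv ex_decode ..
  finally show "\<not> negative_value E \<longleftrightarrow> (\<exists>n. ?c (E, n))" .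
  show "\<not> \<not> negative_value E \<longleftrightarrow> (\<exists>n. ?d (E, n))"
    unfolding negative_value_iff fst_conv snd_conv ex_decode not_not ..
qed

section \<open>Runs of automata\<close>

lemma zmax_sum_ge: "finite S \<Longrightarrow> i \<in> S \<Longrightarrow> f i \<le> (sum f S :: zmax)"
  by (simp add: sum.remove plus_zmax_def)

text \<open>Sums are maxima, and a finite one is attained. This yields a run of the left automaton
  whose weight equals the value.\<close>

lemma zmax_sum_attained: "sum f S = Fin c \<Longrightarrow> \<exists>i\<in>S. f i = Fin c"
proof (induction S rule: infinite_finite_induct)
  case (insert x S)
  then show ?case by (auto simp: plus_zmax_def max_def split: if_splits)
qed (auto simp: zero_zmax_def)

lemma zmax_mult_mono: "a \<le> b \<Longrightarrow> a * c \<le> b * (c :: zmax)"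
  by (cases a; cases b; cases c) auto

text \<open>Programs see a matrix as its list of rows. Positions outside the matrix read as -
  \<infinity>, as padding to two states requires.\<close>

definition entry :: "zmax list list \<Rightarrow> nat \<Rightarrow> nat \<Rightarrow> zmax" where
  "entry L i j = nth_default NegInf (nth_default [] L i) j"

lemma entry_mat_to_list:
  assumes "M \<in> carrier_mat m n"
  shows "entry (mat_to_list M) i j = (if i < m \<and> j < n then M $$ (i, j) else NegInf)"
  using assms by (auto simp: entry_def mat_to_list_def nth_default_def)

text \<open>Automata with fewer than two states are padded with unreachable ones.\<close>

definition mat4_of :: "zmax list list \<Rightarrow> mat4" where
  "mat4_of L = (entry L 0 0, entry L 0 1, entry L 1 0, entry L 1 1)"

definition pad :: "zmax mat \<Rightarrow> zmax \<times> zmax" where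
  "pad v = (entry (mat_to_list v) 0 0, entry (mat_to_list v) 0 1)"

lemma mult_row_entry:
  assumes "v \<in> carrier_mat 1 n" "M \<in> carrier_mat n m" "j < m"
  shows "(v * M) $$ (0, j) = (\<Sum>i<n. v $$ (0, i) * M $$ (i, j))"
  using assms by (simp add: scalar_prod_def atLeast0LessThan)

text \<open>Missing states contribute - \<infinity>, the neutral element of the maximum, so sums
  over zero, one or two states share one formula.\<close>

lemma mult_row_entry_2:
  assumes "v \<in> carrier_mat 1 n" "M \<in> carrier_mat n m" "j < m" "n \<le> 2"
  shows "(v * M) $$ (0, j) =
    fst (pad v) * entry (mat_to_list M) 0 j + snd (pad v) * entry (mat_to_list M) 1 j"
proof -
  consider "n = 0" | "n = 1" | "n = 2" using assms(4) by linarith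
  then show ?thesis
    unfolding mult_row_entry[OF assms(1-3)] pad_def fst_conv snd_conv
      entry_mat_to_list[OF assms(1)] entry_mat_to_list[OF assms(2)]
    using assms(3) by cases (auto simp: plus_zmax_def zero_zmax_def numeral_2_eq_2)
qed

lemma pad_mult:
  assumes "v \<in> carrier_mat 1 n" "M \<in> carrier_mat n n" "n \<le> 2"
  shows "pad (v * M) = vmul (pad v) (mat4_of (mat_to_list M))"
proof -
  have c: "v * M \<in> carrier_mat 1 n" using assms by simp
  have "entry (mat_to_list (v * M)) 0 j =
    fst (pad v) * entry (mat_to_list M) 0 j + snd (pad v) * entry (mat_to_list M) 1 j" for j
  proof (cases "j < n")
    case True
    then show ?thesis
      using entry_mat_to_list[OF c] mult_row_entry_2[OF assms(1,2) True assms(3)] by simp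
  next
    case False
    have "x * NegInf = NegInf" for x by (cases x) auto
    with False show ?thesis
      by (simp add: entry_mat_to_list[OF c] entry_mat_to_list[OF assms(2)] plus_zmax_def)
  qed
  then show ?thesis by (simp add: pad_def[of "v * M"] vmul_def mat4_of_def)
qed

text \<open>\<open>Fin (- c)\<close> is the inverse of the weight \<open>Fin c\<close>. The weight -
  \<infinity> has none; it yields no edge, as a run of that weight cannot refute the
  comparison.\<close>

definition weighted_edge :: "nat \<Rightarrow> zmax \<Rightarrow> mat4 \<Rightarrow> nat \<Rightarrow> edge list" where
  "weighted_edge g m M g' = (case m of NegInf \<Rightarrow> []
     | Fin c \<Rightarrow> [(g, (fst M * Fin (- c), fst (snd M) * Fin (- c), fst (snd (snd M)) * Fin (- c),
         snd (snd (snd M)) * Fin (- c)), g')])"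

text \<open>A path from \<open>0\<close> to \<open>1\<close> is a run of \<open>A\<close>; its matrices are those of \<open>B\<close>, diminished by the
  weights of the run. State \<open>g\<close> of \<open>A\<close> is the vertex \<open>g + 2\<close>.\<close>

definition comparison_graph :: "maxplus_automaton \<Rightarrow> maxplus_automaton \<Rightarrow> edge list" where
  "comparison_graph A B =
     concat (map (\<lambda>g. weighted_edge 0 (entry (mat_to_list (initial A)) 0 g)
       (entry (mat_to_list (initial B)) 0 0, entry (mat_to_list (initial B)) 0 1, NegInf, NegInf)
       (g + 2)) [0..<states A]) @
     concat (map (\<lambda>s. concat (map (\<lambda>g. concat (map (\<lambda>g'. weighted_edge (g + 2)
       (entry (nth_default [] (map mat_to_list (transitions A)) s) g g')
       (mat4_of (nth_default [] (map mat_to_list (transitions B)) s)) (g' + 2)) [0..<states A]))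
       [0..<states A])) [0..<length (map mat_to_list (transitions A))]) @
     concat (map (\<lambda>g. weighted_edge (g + 2) (entry (mat_to_list (final A)) g 0)
       (entry (mat_to_list (final B)) 0 0, NegInf, entry (mat_to_list (final B)) 1 0, NegInf)
       1) [0..<states A])"

lemma initial_edges:
  assumes "h < states A"
  shows "set (weighted_edge 0 (entry (mat_to_list (initial A)) 0 h)
      (entry (mat_to_list (initial B)) 0 0, entry (mat_to_list (initial B)) 0 1, NegInf, NegInf)
      (h + 2)) \<subseteq> set (comparison_graph A B)"
  unfolding comparison_graph_def set_append set_concat set_map image_image
  using assms by (intro le_supI1 UN_upper) simp

lemma final_edges:
  assumes "h < states A"
  shows "set (weighted_edge (h + 2) (entry (mat_to_list (final A)) h 0)
      (entry (mat_to_list (final B)) 0 0, NegInf, entry (mat_to_list (final B)) 1 0, NegInf) 1)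
    \<subseteq> set (comparison_graph A B)"
  unfolding comparison_graph_def set_append set_concat set_map image_image
  using assms by (intro le_supI2 UN_upper) simp

lemma letter_edges:
  assumes "h < states A" "h' < states A" "s < length (transitions A)" "s < length (transitions B)"
  shows "set (weighted_edge (h + 2) (entry (mat_to_list (transitions A ! s)) h h')
      (mat4_of (mat_to_list (transitions B ! s))) (h' + 2)) \<subseteq> set (comparison_graph A B)"
proof -
  have *: "nth_default [] (map mat_to_list (transitions A)) s = mat_to_list (transitions A ! s)"
    "nth_default [] (map mat_to_list (transitions B)) s = mat_to_list (transitions B ! s)"
    using assms by (simp_all add: nth_default_def)
  show ?thesis
    unfolding comparison_graph_def set_append set_concat set_map image_image *[symmetric]
    using assms
    by (intro le_supI2 le_supI1 UN_upper[of s, THEN subset_trans[rotated]]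
        UN_upper[of h, THEN subset_trans[rotated]] UN_upper) simp_all
qed

lemma vmul_weighted_edge:
  assumes "(g, N, g') \<in> set (weighted_edge h m M h')"
  shows "\<exists>c. m = Fin c \<and> g = h \<and> g' = h' \<and> (\<forall>v. vmul v N = vshift (- c) (vmul v M))"
proof -
  from assms obtain c where c: "m = Fin c" "g = h" "g' = h'"
    "N = (fst M * Fin (- c), fst (snd M) * Fin (- c), fst (snd (snd M)) * Fin (- c),
         snd (snd (snd M)) * Fin (- c))"
    by (cases m) (auto simp: weighted_edge_def)
  have "vmul v N = vshift (- c) (vmul v M)" for v
    by (simp add: c(4) vmul_def vshift_def distrib_left mult.commute mult.left_commute)
  with c show ?thesis by blast
qed

lemma reach_weighted_edge:
  assumes "reach E g v" "set (weighted_edge g (Fin c) M g') \<subseteq> set E"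
  shows "reach E g' (vshift (- c) (vmul v M))"
proof -
  obtain N where N: "weighted_edge g (Fin c) M g' = [(g, N, g')]"
    by (simp add: weighted_edge_def)
  then have "\<forall>v. vmul v N = vshift (- c) (vmul v M)"
    using vmul_weighted_edge[of g N g' g "Fin c" M g'] by auto
  moreover have "reach E g' (vmul v N)" using assms N by (auto intro: reach.step)
  ultimately show ?thesis by metis
qed

section \<open>Paths of the comparison graph and runs of the left automaton\<close>

definition prefix_row :: "maxplus_automaton \<Rightarrow> nat list \<Rightarrow> zmax mat" where
  "prefix_row A w = foldl (\<lambda>v s. v * transitions A ! s) (initial A) w"

lemma prefix_row_snoc: "prefix_row A (w @ [s]) = prefix_row A w * transitions A ! s"
  by (simp add: prefix_row_def)

lemma automaton_carrier:
  assumes "automaton_over k A"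
  shows "initial A \<in> carrier_mat 1 (states A)" "final A \<in> carrier_mat (states A) 1"
    "s < k \<Longrightarrow> transitions A ! s \<in> carrier_mat (states A) (states A)"
    "length (transitions A) = k"
  using assms by (auto simp: automaton_over_def)

lemma prefix_row_carrier:
  assumes "automaton_over k A" "w \<in> words k"
  shows "prefix_row A w \<in> carrier_mat 1 (states A)"
  using assms(2)
proof (induction w rule: rev_induct)
  case Nil
  show ?case using automaton_carrier[OF assms(1)] by (simp add: prefix_row_def)
next
  case (snoc s w)
  then show ?case
    using automaton_carrier(3)[OF assms(1), of s] mult_carrier_mat
    by (auto simp: prefix_row_snoc)
qed

lemma series_prefix_row: "series A w = (prefix_row A w * final A) $$ (0, 0)"
  by (simp add: series_def prefix_row_def)

context
  fixes k A B
  assumes A: "automaton_over k A" and B: "automaton_over k B" and two: "states B \<le> 2"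
begin

lemma pad_prefix_row_snoc:
  assumes "w \<in> words k" "s < k"
  shows "pad (prefix_row B (w @ [s])) =
    vmul (pad (prefix_row B w)) (mat4_of (mat_to_list (transitions B ! s)))"
  using pad_mult[OF prefix_row_carrier[OF B assms(1)] automaton_carrier(3)[OF B assms(2)] two]
  by (simp add: prefix_row_snoc)

lemma pad_prefix_row_final:
  assumes "w \<in> words k"
  shows "vmul (pad (prefix_row B w)) (entry (mat_to_list (final B)) 0 0, NegInf,
    entry (mat_to_list (final B)) 1 0, NegInf) = (series B w, NegInf)"
proof -
  have "x * NegInf = NegInf" for x by (cases x) auto
  then show ?thesis
    using mult_row_entry_2[OF prefix_row_carrier[OF B assms] automaton_carrier(2)[OF B] _ two, of 0]
    by (simp add: vmul_def series_prefix_row plus_zmax_def)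
qed

lemma pad_prefix_row_Nil:
  "vmul (Fin 0, NegInf) (entry (mat_to_list (initial B)) 0 0, entry (mat_to_list (initial B)) 0 1,
    NegInf, NegInf) = pad (prefix_row B [])"
  by (simp add: vmul_def pad_def prefix_row_def plus_zmax_def)

text \<open>A path follows a single run, whose weight \<open>c\<close> may fall short of the value
  of \<open>A\<close>; hence the inequalities.\<close>

lemma reach_comparison_graph:
  assumes "reach (comparison_graph A B) g v"
  shows "g = 0 \<and> v = (Fin 0, NegInf) \<or>
    (\<exists>w\<in>words k. \<exists>h<states A. \<exists>c. g = h + 2 \<and> Fin c \<le> prefix_row A w $$ (0, h) \<and>
       v = vshift (- c) (pad (prefix_row B w))) \<or>
    (\<exists>w\<in>words k. \<exists>c. g = 1 \<and> Fin c \<le> series A w \<and> v = vshift (- c) (series B w, NegInf))"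
  using assms
proof induction
  case (step g v N g')
  from step.hyps(2) consider
    (init) h where "h < states A" "(g, N, g') \<in> set (weighted_edge 0 (entry (mat_to_list (initial A)) 0 h)
       (entry (mat_to_list (initial B)) 0 0, entry (mat_to_list (initial B)) 0 1, NegInf, NegInf)
       (h + 2))"
  | (letter) s h h' where "s < k" "h < states A" "h' < states A"
      "(g, N, g') \<in> set (weighted_edge (h + 2) (entry (mat_to_list (transitions A ! s)) h h')
         (mat4_of (mat_to_list (transitions B ! s))) (h' + 2))"
  | (final) h where "h < states A" "(g, N, g') \<in> set (weighted_edge (h + 2)
       (entry (mat_to_list (final A)) h 0) (entry (mat_to_list (final B)) 0 0, NegInf,
         entry (mat_to_list (final B)) 1 0, NegInf) 1)"
    using automaton_carrier(4)[OF A] automaton_carrier(4)[OF B]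
    by (auto simp: comparison_graph_def nth_default_def)
  then show ?case
  proof cases
    case init
    from vmul_weighted_edge[OF init(2)] obtain c where c: "entry (mat_to_list (initial A)) 0 h = Fin c"
      "g = 0" "g' = h + 2" "vmul (Fin 0, NegInf) N = vshift (- c) (pad (prefix_row B []))"
      using pad_prefix_row_Nil by metis
    have "Fin c \<le> prefix_row A [] $$ (0, h)"
      using c(1) init(1) entry_mat_to_list[OF automaton_carrier(1)[OF A]]
      by (simp add: prefix_row_def)
    then show ?thesis using step.IH c init(1) by (intro disjI2 disjI1 bexI[of _ "[]"]) auto
  next
    case letter
    from vmul_weighted_edge[OF letter(4)] obtain m where
      m: "entry (mat_to_list (transitions A ! s)) h h' = Fin m" "g = h + 2" "g' = h' + 2"
      "\<forall>u. vmul u N = vshift (- m) (vmul u (mat4_of (mat_to_list (transitions B ! s))))"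
      by blast
    from step.IH m(2) obtain w c where w: "w \<in> words k" "Fin c \<le> prefix_row A w $$ (0, h)"
      "v = vshift (- c) (pad (prefix_row B w))" by auto
    have "vmul v N = vshift (- (c + m)) (pad (prefix_row B (w @ [s])))"
      unfolding w(3) vmul_vshift m(4)[rule_format] vshift_vshift pad_prefix_row_snoc[OF w(1) letter(1)]
      by (simp add: algebra_simps)
    moreover have "Fin (c + m) \<le> prefix_row A (w @ [s]) $$ (0, h')"
    proof -
      have "Fin (c + m) \<le> prefix_row A w $$ (0, h) * transitions A ! s $$ (h, h')"
        using zmax_mult_mono[OF w(2), of "Fin m"] m(1) letter(2,3)
          entry_mat_to_list[OF automaton_carrier(3)[OF A letter(1)]] by simp
      also have "\<dots> \<le> (\<Sum>i<states A. prefix_row A w $$ (0, i) * transitions A ! s $$ (i, h'))"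
        using letter(2) by (intro zmax_sum_ge) auto
      finally show ?thesis
        unfolding prefix_row_snoc
          mult_row_entry[OF prefix_row_carrier[OF A w(1)] automaton_carrier(3)[OF A letter(1)] letter(3)] .
    qed
    moreover have "w @ [s] \<in> words k" using w(1) letter(1) by auto
    ultimately show ?thesis using m(3) letter(3) by (intro disjI2 disjI1 bexI[of _ "w @ [s]"]) auto
  next
    case final
    from vmul_weighted_edge[OF final(2)] obtain m where
      m: "entry (mat_to_list (final A)) h 0 = Fin m" "g = h + 2" "g' = 1"
      "\<forall>u. vmul u N = vshift (- m) (vmul u (entry (mat_to_list (final B)) 0 0, NegInf,
         entry (mat_to_list (final B)) 1 0, NegInf))"
      by blast
    from step.IH m(2) obtain w c where w: "w \<in> words k" "Fin c \<le> prefix_row A w $$ (0, h)"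
      "v = vshift (- c) (pad (prefix_row B w))" by auto
    have "vmul v N = vshift (- (c + m)) (series B w, NegInf)"
      unfolding w(3) vmul_vshift m(4)[rule_format] vshift_vshift pad_prefix_row_final[OF w(1)]
      by (simp add: algebra_simps)
    moreover have "Fin (c + m) \<le> series A w"
    proof -
      have "Fin (c + m) \<le> prefix_row A w $$ (0, h) * final A $$ (h, 0)"
        using zmax_mult_mono[OF w(2), of "Fin m"] m(1) final(1)
          entry_mat_to_list[OF automaton_carrier(2)[OF A]] by simp
      also have "\<dots> \<le> (\<Sum>i<states A. prefix_row A w $$ (0, i) * final A $$ (i, 0))"
        using final(1) by (intro zmax_sum_ge) auto
      finally show ?thesis
        unfolding series_prefix_row
        by (subst mult_row_entry[OF prefix_row_carrier[OF A w(1)] automaton_carrier(2)[OF A]]) auto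
    qed
    ultimately show ?thesis using m(3) w(1) by (intro disjI2 bexI[of _ w]) auto
  qed
qed simp

lemma times_eq_Fin:
  assumes "x * y = Fin c"
  obtains a b where "x = Fin a" "y = Fin b" "c = a + b"
  using assms by (cases x; cases y) auto

text \<open>Tracing the maximum backwards picks a run that attains the value, and this run is a path
  of the graph.\<close>

lemma prefix_row_reach:
  assumes "w \<in> words k" "h < states A" "prefix_row A w $$ (0, h) = Fin c"
  shows "reach (comparison_graph A B) (h + 2) (vshift (- c) (pad (prefix_row B w)))"
  using assms
proof (induction w arbitrary: h c rule: rev_induct)
  case Nil
  have "entry (mat_to_list (initial A)) 0 h = Fin c"
    using Nil entry_mat_to_list[OF automaton_carrier(1)[OF A], of 0 h] by (simp add: prefix_row_def)
  note edges = initial_edges[OF Nil(2), of B, unfolded this]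
  from reach_weighted_edge[OF reach.start edges] show ?case
    unfolding pad_prefix_row_Nil .
next
  case (snoc s w)
  then have w: "w \<in> words k" "s < k" by auto
  have "(\<Sum>i<states A. prefix_row A w $$ (0, i) * transitions A ! s $$ (i, h)) = Fin c"
    using snoc.prems(3) unfolding prefix_row_snoc
      mult_row_entry[OF prefix_row_carrier[OF A w(1)] automaton_carrier(3)[OF A w(2)] snoc.prems(2)] .
  then obtain i where i: "i < states A"
    "prefix_row A w $$ (0, i) * transitions A ! s $$ (i, h) = Fin c"
    using zmax_sum_attained by blast
  from i(2) obtain a b where ab: "prefix_row A w $$ (0, i) = Fin a"
    "transitions A ! s $$ (i, h) = Fin b" "c = a + b"
    by (rule times_eq_Fin)
  have "entry (mat_to_list (transitions A ! s)) i h = Fin b"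
    using i(1) snoc.prems(2) entry_mat_to_list[OF automaton_carrier(3)[OF A w(2)], of i h] ab(2)
    by simp
  note edges = letter_edges[OF i(1) snoc.prems(2), of s B,
      unfolded automaton_carrier(4)[OF A] automaton_carrier(4)[OF B] this, OF w(2) w(2)]
  from reach_weighted_edge[OF snoc.IH[OF w(1) i(1) ab(1)] edges] show ?case
    by (simp add: vmul_vshift vshift_vshift pad_prefix_row_snoc[OF w] ab(3) add.commute)
qed

lemma series_reach:
  assumes "w \<in> words k" "series A w = Fin c"
  shows "reach (comparison_graph A B) 1 (vshift (- c) (series B w, NegInf))"
proof -
  have "(\<Sum>i<states A. prefix_row A w $$ (0, i) * final A $$ (i, 0)) = Fin c"
    using assms(2) mult_row_entry[OF prefix_row_carrier[OF A assms(1)] automaton_carrier(2)[OF A]]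
    by (simp add: series_prefix_row)
  then obtain i where i: "i < states A" "prefix_row A w $$ (0, i) * final A $$ (i, 0) = Fin c"
    using zmax_sum_attained by blast
  from i(2) obtain a b where ab: "prefix_row A w $$ (0, i) = Fin a" "final A $$ (i, 0) = Fin b"
    "c = a + b"
    by (rule times_eq_Fin)
  have "entry (mat_to_list (final A)) i 0 = Fin b"
    using i(1) entry_mat_to_list[OF automaton_carrier(2)[OF A], of i 0] ab(2) by simp
  note edges = final_edges[OF i(1), of B, unfolded this]
  from reach_weighted_edge[OF prefix_row_reach[OF assms(1) i(1) ab(1)] edges] show ?thesis
    unfolding vmul_vshift vshift_vshift pad_prefix_row_final[OF assms(1)]
    by (simp add: ab(3) add.commute)
qed

text \<open>If some run of \<open>A\<close> beats \<open>B\<close>, then so does the value of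
  \<open>A\<close>; conversely a value of \<open>A\<close> that beats \<open>B\<close> is finite,
  hence attained by a run.\<close>

lemma comparison_iff:
  "(\<forall>w\<in>words k. series A w \<le> series B w) \<longleftrightarrow> \<not> negative_value (comparison_graph A B)"
proof -
  have less: "Fin (- c) * x < Fin 0 \<longleftrightarrow> x < Fin c" for x c
    by (cases x) (auto simp: less_zmax_def)
  have "negative_value (comparison_graph A B) \<longleftrightarrow> (\<exists>w\<in>words k. series B w < series A w)"
  proof
    assume "negative_value (comparison_graph A B)"
    then obtain z where z: "z < Fin 0" "reach (comparison_graph A B) 1 (z, NegInf)"
      unfolding negative_value_def by blast
    from reach_comparison_graph[OF z(2)] obtain w c where "w \<in> words k" "Fin c \<le> series A w"
      "(z, NegInf) = vshift (- c) (series B w, NegInf)" by auto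
    then show "\<exists>w\<in>words k. series B w < series A w"
      using z(1) less less_le_trans by (fastforce simp: vshift_def)
  next
    assume "\<exists>w\<in>words k. series B w < series A w"
    then obtain w where w: "w \<in> words k" "series B w < series A w" by blast
    then obtain c where c: "series A w = Fin c" by (cases "series A w") (auto simp: less_zmax_def)
    then show "negative_value (comparison_graph A B)"
      using series_reach[OF w(1) c] w(2) less unfolding negative_value_def vshift_def by fastforce
  qed
  then show ?thesis by (metis not_le)
qed

end

section \<open>Reading automata from their codes, and the decision procedures\<close>

lemma encode_nat_list: "encode (xs :: nat list) = list_encode xs"
  by (simp add: encode_list_def encode_nat_def[abs_def])

lemma computable_nat_list_nth: "computable (\<lambda>n. nth_default 0 (decode n :: nat list) i)"
  by (intro computable)

lemma decode_list_encode: "decode (list_encode xs) = (xs :: nat list)"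
  by (metis decode_encode encode_nat_list)

lemma encode_mat_to_list: "encode (mat_to_list M) = mat_encode M"
  by (simp add: encode_list_def[abs_def] encode_zmax_def mat_encode_def)

text \<open>The code of an automaton is that of a list of four numbers, and matrices are coded by
  their lists of rows. So on codes each component is an entry of the decoded list; the default
  \<open>0\<close> keeps the function total elsewhere.\<close>

lemma computable_automaton [computable]:
  assumes "computable f"
  shows "computable (\<lambda>x. states (f x))" "computable (\<lambda>x. mat_to_list (initial (f x)))"
    "computable (\<lambda>x. map mat_to_list (transitions (f x)))"
    "computable (\<lambda>x. mat_to_list (final (f x)))"
proof -
  have code: "decode (encode A) = [states A, mat_encode (initial A),
      list_encode (map mat_encode (transitions A)), mat_encode (final A)]" for A :: maxplus_automaton
    unfolding encode_maxplus_automaton_def automaton_encode_def decode_list_encode ..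
  have "computable states" "computable (\<lambda>A. mat_to_list (initial A))"
    "computable (\<lambda>A. map mat_to_list (transitions A))" "computable (\<lambda>A. mat_to_list (final A))"
    by (rule computableI[OF computable_nat_list_nth[of 0]]
          computableI[OF computable_nat_list_nth[of 1]] computableI[OF computable_nat_list_nth[of 2]]
          computableI[OF computable_nat_list_nth[of 3]];
        simp add: code encode_mat_to_list nth_default_def
          encode_list_def[where 'a = "zmax list list"] comp_def; fail)+
  from this[THEN computable_compose, OF assms] show "computable (\<lambda>x. states (f x))"
    "computable (\<lambda>x. mat_to_list (initial (f x)))"
    "computable (\<lambda>x. map mat_to_list (transitions (f x)))"
    "computable (\<lambda>x. mat_to_list (final (f x)))" .
qed

lemma computable_entry [computable]:
  "computable L \<Longrightarrow> computable i \<Longrightarrow> computable j \<Longrightarrow> computable (\<lambda>x. entry (L x) (i x) (j x))"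
  unfolding entry_def by (intro computable)

lemma computable_mat4_of [computable]: "computable L \<Longrightarrow> computable (\<lambda>x. mat4_of (L x))"
  unfolding mat4_of_def by (intro computable)

lemma computable_weighted_edge [computable]:
  assumes "computable g" "computable m" "computable M" "computable g'"
  shows "computable (\<lambda>x. weighted_edge (g x) (m x) (M x) (g' x))"
proof -
  have "computable (\<lambda>p. weighted_edge (fst p) (fst (snd p)) (fst (snd (snd p))) (snd (snd (snd p))))"
    unfolding weighted_edge_def by (intro computable)
  from computable_compose[OF this, of "\<lambda>x. (g x, m x, M x, g' x)"] assms show ?thesis
    by (simp add: computable_Pair)
qed

lemma computable_comparison_graph: "computable (\<lambda>p. comparison_graph (fst p) (snd p))"
  unfolding comparison_graph_def by (intro computable)

text \<open>\<open>F\<close> supplies the paths and \<open>G\<close> the two-entry vectors along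
  them, so \<open>G\<close> carries the bound of two states. The three problems differ only in the
  choice of \<open>F\<close>, \<open>G\<close> and the recoding \<open>g\<close>.\<close>

lemma decidable_comparison_graph:
  fixes g :: "nat \<Rightarrow> nat"
  assumes "computable g"
    and "\<And>x. x \<in> I \<Longrightarrow> g (enc x) = encode (F x, G x)"
    and "\<And>x. x \<in> I \<Longrightarrow> \<exists>k. automaton_over k (F x) \<and> automaton_over k (G x) \<and> states (G x) \<le> 2 \<and>
      (P x \<longleftrightarrow> (\<forall>w\<in>words k. series (F x) w \<le> series (G x) w))"
  shows "decidable enc I P"
proof -
  obtain h :: "nat \<Rightarrow> nat" where h: "computable h"
    "\<And>p. h (encode p) = encode (comparison_graph (fst p) (snd p))"
    using computableE[OF computable_comparison_graph] by blast
  show ?thesis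
  proof (rule decidable_reduce[OF decidable_nonnegative_value])
    show "computable (\<lambda>n. h (g n))" by (rule computable_compose[OF h(1) assms(1)])
    fix x
    assume x: "x \<in> I"
    show "comparison_graph (F x) (G x) \<in> UNIV \<and>
        h (g (enc x)) = encode (comparison_graph (F x) (G x)) \<and>
        (P x \<longleftrightarrow> \<not> negative_value (comparison_graph (F x) (G x)))"
      using assms(3)[OF x] comparison_iff h(2)[of "(F x, G x)"] assms(2)[OF x] by auto
  qed
qed

lemma decidable_cong:
  "decidable enc I P \<Longrightarrow> (\<And>x. x \<in> I \<Longrightarrow> P x \<longleftrightarrow> Q x) \<Longrightarrow> decidable enc I Q"
  by (simp add: decidable_def)

text \<open>Its series is constantly 0 on words over the alphabet, which turns positivity into a
  comparison.\<close>

definition zero_automaton :: "nat \<Rightarrow> maxplus_automaton" where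
  "zero_automaton k = Automaton 1 (mat 1 1 (\<lambda>_. Fin 0)) (replicate k (mat 1 1 (\<lambda>_. Fin 0)))
     (mat 1 1 (\<lambda>_. Fin 0))"

lemma zero_automaton_over: "automaton_over k (zero_automaton k)"
  by (auto simp: automaton_over_def zero_automaton_def)

lemma series_zero_automaton:
  assumes "w \<in> words k"
  shows "series (zero_automaton k) w = Fin 0"
proof -
  have one: "mat 1 1 (\<lambda>_. Fin 0) * mat 1 1 (\<lambda>_. Fin 0) = mat 1 1 (\<lambda>_. Fin 0)"
    by (rule eq_matI) (auto simp: scalar_prod_def)
  have "prefix_row (zero_automaton k) w = mat 1 1 (\<lambda>_. Fin 0)"
    using assms
  proof (induction w rule: rev_induct)
    case Nil
    show ?case by (simp add: prefix_row_def zero_automaton_def)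
  next
    case (snoc s w)
    then show ?case by (simp add: prefix_row_snoc) (simp add: zero_automaton_def one[unfolded One_nat_def])
  qed
  then show ?thesis
    unfolding series_prefix_row by (simp add: zero_automaton_def one[unfolded One_nat_def])
qed

theorem corollary1p2:
  "decidable pair_encode
     {(k, A, B). automaton_over k A \<and> automaton_over k B \<and> states A \<le> 2 \<and> states B \<le> 2}
     (\<lambda>(k, A, B). \<forall>w\<in>words k. series A w \<le> series B w) \<and>
   decidable pair_encode
     {(k, A, B). automaton_over k A \<and> automaton_over k B \<and> states A \<le> 2 \<and> states B \<le> 2}
     (\<lambda>(k, A, B). \<forall>w\<in>words k. series A w = series B w) \<and>
   (\<forall>k. decidable automaton_encode
     {B. automaton_over k B \<and> states B = 2}
     (\<lambda>B. \<forall>w\<in>words k. Fin 0 \<le> series B w))"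
proof (intro conjI allI)
  let ?I = "{(k, A, B). automaton_over k A \<and> automaton_over k B \<and> states A \<le> 2 \<and> states B \<le> 2}"
  let ?nth = "\<lambda>n i. nth_default 0 (decode n :: nat list) i"
  have code: "decode (pair_encode x) =
      [fst x, automaton_encode (fst (snd x)), automaton_encode (snd (snd x))]" for x
    unfolding pair_encode_def case_prod_beta decode_list_encode ..
  \<comment> \<open>Entry 0 of the code of an instance is the alphabet size; entries 1 and 2 are the
    two automata, taken in either order.\<close>
  have nth: "computable (\<lambda>n. encode (?nth n i, ?nth n j))" for i j by (intro computable)
  have le: "decidable pair_encode ?I
      (\<lambda>x. \<forall>w\<in>words (fst x). series (fst (snd x)) w \<le> series (snd (snd x)) w)"
    by (rule decidable_comparison_graph[OF nth[of 1 2],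
          where F = "\<lambda>x. fst (snd x)" and G = "\<lambda>x. snd (snd x)"])
      (auto simp: code encode_prod_def encode_maxplus_automaton_def nth_default_def)
  have ge: "decidable pair_encode ?I
      (\<lambda>x. \<forall>w\<in>words (fst x). series (snd (snd x)) w \<le> series (fst (snd x)) w)"
    by (rule decidable_comparison_graph[OF nth[of 2 1],
          where F = "\<lambda>x. snd (snd x)" and G = "\<lambda>x. fst (snd x)"])
      (auto simp: code encode_prod_def encode_maxplus_automaton_def nth_default_def)
  from le show "decidable pair_encode ?I (\<lambda>(k, A, B). \<forall>w\<in>words k. series A w \<le> series B w)"
    by (rule decidable_cong) auto
  from decidable_conj[OF le ge]
  show "decidable pair_encode ?I (\<lambda>(k, A, B). \<forall>w\<in>words k. series A w = series B w)"
    by (rule decidable_cong) (simp add: case_prod_beta eq_iff[of "series _ _"] ball_conj_distrib)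
  fix k
  show "decidable automaton_encode {B. automaton_over k B \<and> states B = 2}
     (\<lambda>B. \<forall>w\<in>words k. Fin 0 \<le> series B w)"
  proof (rule decidable_comparison_graph[where F = "\<lambda>_. zero_automaton k" and G = "\<lambda>B. B"])
    \<comment> \<open>The alphabet size is fixed, so the code of the zero automaton is a
      constant.\<close>
    show "computable (\<lambda>n. encode (automaton_encode (zero_automaton k), n))"
      by (intro computable)
    fix B
    assume "B \<in> {B. automaton_over k B \<and> states B = 2}"
    then show "\<exists>l. automaton_over l (zero_automaton k) \<and> automaton_over l B \<and> states B \<le> 2 \<and>
      ((\<forall>w\<in>words k. Fin 0 \<le> series B w) \<longleftrightarrow>
        (\<forall>w\<in>words l. series (zero_automaton k) w \<le> series B w))"
      using zero_automaton_over series_zero_automaton by (intro exI[of _ k]) auto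
  qed (simp add: encode_prod_def encode_maxplus_automaton_def)
qed

end
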